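(* Let $k$, $m$ and $n$ be positive integers. Let $A_1,\ldots,A_n$ be subsets of $\mathbb{C}$ each of cardinality $k$, and for $1\leqslant i<j\leqslant n$ let $S_{ij}$ be a subset of $\mathbb{C}$ with at most $2m-1$ elements. Let $q$ be a positive odd integer and let $\zeta_1,\ldots,\zeta_n$ be distinct $q$th roots of unity. Then $$\Big|\Big\{\sum_{i=1}^n a_i:\ a_i\in A_i \text{ for all } i,\ a_i\zeta_i\neq a_j\zeta_j\ \text{and}\ a_i-a_j\notin S_{ij}\ \text{whenever}\ i<j\Big\}\Big|\geqslant (k-1-m(n-1))n+1.$$ *)

theory Defs
  imports Complex_Main
begin

end

theory Submission
  imports Defs "HOL-Library.FuncSet" "HOL-Combinatorics.Permutations"
    "HOL-Computational_Algebra.Polynomial"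
begin

text \<open>
  Put \<open>K = k - 1\<close>, \<open>d = K - m (n - 1)\<close> and \<open>N = n d\<close>. If the set of sums were contained in a set \<open>C\<close> of
  size \<open>N\<close>, the product of all \<open>x\<^sub>j \<zeta>\<^sub>j - x\<^sub>i \<zeta>\<^sub>i\<close>, all \<open>x\<^sub>i - x\<^sub>j - s\<close> and all \<open>x\<^sub>1 + \<dots> + x\<^sub>n - c\<close> would
  vanish on \<open>A\<^sub>1 \<times> \<dots> \<times> A\<^sub>n\<close>. Its degree is \<open>n K\<close>, so by the combinatorial Nullstellensatz (summation
  over the grid with the Lagrange weights) the coefficient of \<open>\<Prod> x\<^sub>i ^ K\<close> in
  \<open>V(\<zeta> x) V(x) ^ (2 m - 1) (\<Sum> x\<^sub>i) ^ N\<close> would be zero, where \<open>V\<close> is the Vandermonde product. The same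
  coefficient is computed as an average over a grid of roots of unity of large order \<open>M\<close>, a discrete
  torus, where variables can be permuted freely.

  Expanding \<open>V(\<zeta> x)\<close> over permutations and using the antisymmetry of \<open>V(x)\<close>, the coefficient is, up to
  the factor \<open>n!\<close>, the permanent of the matrix \<open>\<zeta>\<^sub>i ^ (j - 1)\<close> times the coefficient of \<open>\<Prod> x\<^sub>i ^ K\<close>
  in \<open>V ^ (2 m) (\<Sum> x\<^sub>i) ^ N\<close>. The permanent is congruent modulo 2 to the determinant \<open>V(\<zeta>)\<close>, which divides
  a power of the odd number \<open>q\<close> in the ring generated by the \<open>q\<close>th roots of unity, in which 2 is not
  a unit. The second factor is treated by Aomoto's method for Selberg integrals: integration by parts
  in one variable at a time relates the coefficient for \<open>(K, N)\<close> to that for \<open>(K - 1, N - n)\<close>, and for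
  \<open>N = 0\<close> it is, up to sign, the average of \<open>\<bar>V\<bar> ^ (2 m)\<close> over the torus, which is positive.
\<close>

section \<open>Weighted sums over grids\<close>

text \<open>The nodes and weights may vary with the variable, so that one notion covers both the
  Lagrange weights on the sets \<open>A i\<close> of the theorem and the weights on roots of
  unity.\<close>

definition grid_sum ::
    "nat set \<Rightarrow> (nat \<Rightarrow> complex set) \<Rightarrow> (nat \<Rightarrow> complex \<Rightarrow> complex) \<Rightarrow> ((nat \<Rightarrow> complex) \<Rightarrow> complex) \<Rightarrow> complex"
  where "grid_sum I A w f = (\<Sum>a\<in>PiE I A. (\<Prod>i\<in>I. w i (a i)) * f a)"

lemma grid_sum_add: "grid_sum I A w (\<lambda>a. f a + g a) = grid_sum I A w f + grid_sum I A w g"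
  by (simp add: grid_sum_def sum.distrib algebra_simps)

lemma grid_sum_diff: "grid_sum I A w (\<lambda>a. f a - g a) = grid_sum I A w f - grid_sum I A w g"
  by (simp add: grid_sum_def sum_subtractf algebra_simps)

lemma grid_sum_cmult: "grid_sum I A w (\<lambda>a. c * f a) = c * grid_sum I A w f"
  by (simp add: grid_sum_def sum_distrib_left algebra_simps)

lemma grid_sum_sum: "grid_sum I A w (\<lambda>a. \<Sum>j\<in>J. f j a) = (\<Sum>j\<in>J. grid_sum I A w (f j))"
  unfolding grid_sum_def by (subst sum.swap) (simp add: sum_distrib_left)

lemma grid_sum_eq_0: "(\<And>a. a \<in> PiE I A \<Longrightarrow> f a = 0) \<Longrightarrow> grid_sum I A w f = 0"
  by (simp add: grid_sum_def)

text \<open>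
  With such weights, \<open>grid_sum\<close> extracts the coefficient of \<open>\<Prod>i\<in>I. x i ^ K\<close>
  from a polynomial of total degree at most \<open>card I * K\<close>.
\<close>

definition leading_moments ::
    "nat set \<Rightarrow> nat \<Rightarrow> (nat \<Rightarrow> complex set) \<Rightarrow> (nat \<Rightarrow> complex \<Rightarrow> complex) \<Rightarrow> bool"
  where "leading_moments I K A w \<longleftrightarrow> (\<forall>i\<in>I. finite (A i) \<and>
           (\<forall>j\<le>K. (\<Sum>x\<in>A i. w i x * x ^ j) = (if j = K then 1 else 0)))"

text \<open>The sum factors into one moment per variable. Moments of order above \<open>K\<close>
  are unspecified, but under the degree bound such an exponent forces another one below
  \<open>K\<close>, whose moment is 0.\<close>

lemma grid_sum_monomial:
  assumes I: "finite I" and mom: "leading_moments I K A w" and le: "(\<Sum>i\<in>I. \<alpha> i) \<le> card I * K"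
  shows "grid_sum I A w (\<lambda>a. \<Prod>i\<in>I. a i ^ \<alpha> i) = (if \<forall>i\<in>I. \<alpha> i = K then 1 else 0)"
proof -
  have "grid_sum I A w (\<lambda>a. \<Prod>i\<in>I. a i ^ \<alpha> i) = (\<Prod>i\<in>I. \<Sum>x\<in>A i. w i x * x ^ \<alpha> i)"
    using I mom by (subst prod_sum_PiE) (auto simp: grid_sum_def leading_moments_def prod.distrib)
  also have "\<dots> = (if \<forall>i\<in>I. \<alpha> i = K then 1 else 0)"
  proof (cases "\<forall>i\<in>I. \<alpha> i = K")
    case True
    then show ?thesis using mom by (auto simp: leading_moments_def intro!: prod.neutral)
  next
    case False
    have "\<exists>i\<in>I. \<alpha> i < K"
    proof (rule ccontr)
      assume "\<not> (\<exists>i\<in>I. \<alpha> i < K)"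
      then have *: "\<And>i. i \<in> I \<Longrightarrow> K \<le> \<alpha> i" by (simp add: not_less)
      from False obtain i where i: "i \<in> I" "\<alpha> i \<noteq> K" by blast
      have "(\<Sum>i\<in>I. K) < (\<Sum>i\<in>I. \<alpha> i)"
        using I i * le_neq_implies_less by (intro sum_strict_mono_ex1) fastforce+
      with le show False by simp
    qed
    then obtain i where "i \<in> I" "\<alpha> i < K" by blast
    then have "(\<Sum>x\<in>A i. w i x * x ^ \<alpha> i) = 0"
      using mom by (auto simp: leading_moments_def)
    then show ?thesis using False \<open>i \<in> I\<close> I by (auto intro: prod_zero)
  qed
  finally show ?thesis .
qed

text \<open>
  \<open>affine_prod I d f g\<close>: \<open>f\<close> is a product of \<open>d\<close> affine forms in the variables \<open>I\<close>, and \<open>g\<close> is the product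
  of their linear parts, that is, the component of \<open>f\<close> of degree \<open>d\<close>.
\<close>

inductive affine_prod ::
    "nat set \<Rightarrow> nat \<Rightarrow> ((nat \<Rightarrow> complex) \<Rightarrow> complex) \<Rightarrow> ((nat \<Rightarrow> complex) \<Rightarrow> complex) \<Rightarrow> bool"
  for I where
  one: "affine_prod I 0 (\<lambda>x. 1) (\<lambda>x. 1)"
| step: "affine_prod I d f g \<Longrightarrow>
    affine_prod I (Suc d) (\<lambda>x. ((\<Sum>i\<in>I. c i * x i) - s) * f x) (\<lambda>x. (\<Sum>i\<in>I. c i * x i) * g x)"

lemma monomial_times_var:
  fixes x :: "nat \<Rightarrow> complex"
  assumes "finite I" "i \<in> I"
  shows "(\<Prod>j\<in>I. x j ^ \<alpha> j) * x i = (\<Prod>j\<in>I. x j ^ (\<alpha>(i := Suc (\<alpha> i))) j)"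
proof -
  have "(\<Prod>j\<in>I - {i}. x j ^ (\<alpha>(i := Suc (\<alpha> i))) j) = (\<Prod>j\<in>I - {i}. x j ^ \<alpha> j)"
    by (rule prod.cong) auto
  then show ?thesis using assms by (simp add: prod.remove[of I i])
qed

lemma degree_times_var:
  assumes "finite I" "i \<in> I"
  shows "(\<Sum>j\<in>I. (\<alpha>(i := Suc (\<alpha> i))) j) = Suc (\<Sum>j\<in>I. \<alpha> j)"
proof -
  have "(\<Sum>j\<in>I - {i}. (\<alpha>(i := Suc (\<alpha> i))) j) = (\<Sum>j\<in>I - {i}. \<alpha> j)"
    by (rule sum.cong) auto
  then show ?thesis using assms by (simp add: sum.remove[of I i])
qed

text \<open>Expands one affine factor and absorbs each variable into the monomial in front. Carrying
  such a monomial through the inductions below replaces the expansion of \<open>f\<close> as a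
  multivariate polynomial.\<close>

lemma grid_sum_affine_step:
  assumes "finite I"
  shows "grid_sum I A w (\<lambda>x. (\<Prod>i\<in>I. x i ^ \<alpha> i) * (((\<Sum>i\<in>I. c i * x i) - s) * f x)) =
    (\<Sum>i\<in>I. c i * grid_sum I A w (\<lambda>x. (\<Prod>j\<in>I. x j ^ (\<alpha>(i := Suc (\<alpha> i))) j) * f x)) -
    s * grid_sum I A w (\<lambda>x. (\<Prod>i\<in>I. x i ^ \<alpha> i) * f x)"
proof -
  have "(\<lambda>x. (\<Prod>i\<in>I. x i ^ \<alpha> i) * (((\<Sum>i\<in>I. c i * x i) - s) * f x)) =
    (\<lambda>x. (\<Sum>i\<in>I. c i * ((\<Prod>j\<in>I. x j ^ (\<alpha>(i := Suc (\<alpha> i))) j) * f x)) - s * ((\<Prod>i\<in>I. x i ^ \<alpha> i) * f x))"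
    by (rule ext, simp only: monomial_times_var[OF assms, symmetric] cong: sum.cong)
       (simp add: algebra_simps sum_distrib_left)
  then show ?thesis
    by (simp add: grid_sum_diff grid_sum_sum grid_sum_cmult)
qed

lemma grid_sum_low_degree:
  assumes "affine_prod I d f g" "finite I" "leading_moments I K A w"
    and "(\<Sum>i\<in>I. \<alpha> i) + d < card I * K"
  shows "grid_sum I A w (\<lambda>x. (\<Prod>i\<in>I. x i ^ \<alpha> i) * f x) = 0"
  using assms
proof (induction arbitrary: \<alpha> rule: affine_prod.induct)
  case one
  then have "(\<Sum>i\<in>I. \<alpha> i) \<noteq> (\<Sum>i\<in>I. K)" by simp
  then have "\<not> (\<forall>i\<in>I. \<alpha> i = K)" by (metis sum.cong)
  with grid_sum_monomial[OF one(1,2), of \<alpha>] one(3) show ?case by simp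
next
  case (step d f g c s)
  have "grid_sum I A w (\<lambda>x. (\<Prod>j\<in>I. x j ^ (\<alpha>(i := Suc (\<alpha> i))) j) * f x) = 0" if "i \<in> I" for i
    using step.prems that degree_times_var[OF \<open>finite I\<close> that, of \<alpha>] by (intro step.IH) auto
  moreover have "grid_sum I A w (\<lambda>x. (\<Prod>i\<in>I. x i ^ \<alpha> i) * f x) = 0"
    using step.prems by (intro step.IH) auto
  ultimately show ?case using step.prems(1) by (simp add: grid_sum_affine_step)
qed

text \<open>When an affine factor is expanded, its constant term leaves a product of too low a
  degree, which \<open>grid_sum_low_degree\<close> kills; only linear parts survive. On the side of
  \<open>g\<close> the expansion is used with constant term 0.\<close>

lemma grid_sum_leading_part_monomial:
  assumes "affine_prod I d f g" "finite I" "leading_moments I K A w" "leading_moments I K A' w'"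
    and "(\<Sum>i\<in>I. \<alpha> i) + d = card I * K"
  shows "grid_sum I A w (\<lambda>x. (\<Prod>i\<in>I. x i ^ \<alpha> i) * f x) =
    grid_sum I A' w' (\<lambda>x. (\<Prod>i\<in>I. x i ^ \<alpha> i) * g x)"
  using assms
proof (induction arbitrary: \<alpha> rule: affine_prod.induct)
  case one
  with grid_sum_monomial[OF one(1,2), of \<alpha>] grid_sum_monomial[OF one(1,3), of \<alpha>]
  show ?case by simp
next
  case (step d f g c s)
  have "grid_sum I A w (\<lambda>x. (\<Prod>j\<in>I. x j ^ (\<alpha>(i := Suc (\<alpha> i))) j) * f x) =
    grid_sum I A' w' (\<lambda>x. (\<Prod>j\<in>I. x j ^ (\<alpha>(i := Suc (\<alpha> i))) j) * g x)" if "i \<in> I" for i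
    using step.prems that degree_times_var[OF \<open>finite I\<close> that, of \<alpha>] by (intro step.IH) auto
  moreover have "grid_sum I A w (\<lambda>x. (\<Prod>i\<in>I. x i ^ \<alpha> i) * f x) = 0"
    using step.prems step.hyps by (intro grid_sum_low_degree) auto
  ultimately show ?case
    using step.prems(1) grid_sum_affine_step[OF step.prems(1), of A' w' \<alpha> c 0 g]
    by (simp add: grid_sum_affine_step)
qed

text \<open>The combinatorial Nullstellensatz in the form needed here: both sides are the
  coefficient of the monomial with all exponents \<open>K\<close>, so the computation can be moved
  from one grid to another.\<close>

lemma grid_sum_leading_part:
  assumes "affine_prod I (card I * K) f g" "finite I"
    and "leading_moments I K A w" "leading_moments I K A' w'"
  shows "grid_sum I A w f = grid_sum I A' w' g"
  using grid_sum_leading_part_monomial[OF assms, of "\<lambda>_. 0"] by simp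

lemma affine_prod_mult:
  assumes "affine_prod I d f g" "affine_prod I d' f' g'"
  shows "affine_prod I (d + d') (\<lambda>x. f x * f' x) (\<lambda>x. g x * g' x)"
  using assms
proof (induction rule: affine_prod.induct)
  case (step d f g c s)
  from affine_prod.step[OF step.IH[OF step.prems], of c s] show ?case
    by (simp add: mult.assoc)
qed simp

lemma affine_prod_prod:
  assumes "finite T" "\<And>t. t \<in> T \<Longrightarrow> affine_prod I (d t) (f t) (g t)"
  shows "affine_prod I (\<Sum>t\<in>T. d t) (\<lambda>x. \<Prod>t\<in>T. f t x) (\<lambda>x. \<Prod>t\<in>T. g t x)"
  using assms
proof (induction T rule: finite_induct)
  case empty
  then show ?case by (simp add: affine_prod.one)
next
  case (insert t T)
  then show ?case by (simp add: affine_prod_mult)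
qed

lemma affine_prod_single:
  "affine_prod I 1 (\<lambda>x. (\<Sum>i\<in>I. c i * x i) - s) (\<lambda>x. \<Sum>i\<in>I. c i * x i)"
  using affine_prod.step[OF affine_prod.one, of I c s] by simp

lemma affine_prod_diff:
  assumes "finite I" "i \<in> I" "j \<in> I"
  shows "affine_prod I 1 (\<lambda>x. u * x i - v * x j - s) (\<lambda>x. u * x i - v * x j)"
proof -
  have "(\<Sum>l\<in>I. ((if l = i then u else 0) - (if l = j then v else 0)) * x l) = u * x i - v * x j"
    for x :: "nat \<Rightarrow> complex"
    using assms by (simp add: left_diff_distrib sum_subtractf if_distrib[of "\<lambda>t. t * _"] cong: if_cong)
  with affine_prod_single[of I "\<lambda>l. (if l = i then u else 0) - (if l = j then v else 0)" s]
  show ?thesis by simp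
qed

text \<open>The polynomial \<open>monom 1 j\<close> is its own Lagrange interpolant at
  \<open>K + 1\<close> points; comparing coefficients of degree \<open>K\<close> gives the
  moments.\<close>

lemma lagrange_leading_moments:
  assumes "\<And>i. i \<in> I \<Longrightarrow> finite (A i) \<and> card (A i) = Suc K"
  shows "leading_moments I K A (\<lambda>i x. 1 / (\<Prod>y\<in>A i - {x}. x - y))"
proof -
  have "(\<Sum>x\<in>X. 1 / (\<Prod>y\<in>X - {x}. x - y) * x ^ j) = (if j = K then 1 else 0)"
    if X: "finite X" "card X = Suc K" and j: "j \<le> K" for X :: "complex set" and j
  proof -
    define L where "L x = (\<Prod>y\<in>X - {x}. [:- y, 1:])" for x
    define Q where "Q = (\<Sum>x\<in>X. smult (x ^ j / (\<Prod>y\<in>X - {x}. x - y)) (L x))"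
    have degL: "degree (L x) = K" and lcL: "lead_coeff (L x) = 1" if "x \<in> X" for x
    proof -
      show "degree (L x) = K"
        using X that unfolding L_def by (simp add: degree_prod_eq_sum_degree)
      show "lead_coeff (L x) = 1"
        unfolding L_def lead_coeff_prod by simp
    qed
    have "Q = monom 1 j"
    proof (rule poly_eqI_degree[where A = X])
      show "card X > degree (monom (1::complex) j)" using X j by (simp add: degree_monom_eq)
      have "degree Q \<le> K" unfolding Q_def
        by (rule degree_sum_le) (use X degL in \<open>auto intro: order_trans[OF degree_smult_le]\<close>)
      then show "card X > degree Q" using X by simp
    next
      fix z assume z: "z \<in> X"
      have "poly (L x) z = 0" if "x \<in> X" "x \<noteq> z" for x
        using that z X unfolding L_def by (auto simp: poly_prod intro!: prod_zero)
      then have "poly Q z = (\<Sum>x\<in>X. if x = z then z ^ j / (\<Prod>y\<in>X - {z}. z - y) * poly (L z) z else 0)"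
        unfolding Q_def poly_sum by (intro sum.cong) auto
      also have "\<dots> = z ^ j"
        using z X by (simp add: L_def poly_prod)
      finally show "poly Q z = poly (monom 1 j) z" by (simp add: poly_monom)
    qed
    then have "coeff Q K = (if j = K then 1 else 0)" by simp
    moreover have "coeff (L x) K = 1" if "x \<in> X" for x using lcL degL that by fastforce
    ultimately show ?thesis by (simp add: Q_def coeff_sum cong: sum.cong)
  qed
  with assms show ?thesis by (simp add: leading_moments_def)
qed

section \<open>Integer combinations of roots of unity\<close>

text \<open>Nakayama's lemma at the prime 2.\<close>

lemma halvable_generators_eq_0:
  fixes X :: "complex set"
  assumes "finite X"
    and "\<And>x. x \<in> X \<Longrightarrow> \<exists>b c. odd b \<and> of_int b * x = 2 * (\<Sum>y\<in>X. of_int (c y) * y)"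
  shows "x \<in> X \<Longrightarrow> x = 0"
  using assms
proof (induction X arbitrary: x rule: finite_induct)
  case (insert v X)
  obtain b c where b: "odd b" "of_int b * v = 2 * (\<Sum>y\<in>insert v X. of_int (c y) * y)"
    using insert.prems(2)[of v] by blast
  \<comment> \<open>The term of \<open>v\<close> itself is moved to the left. The multiplier stays
    odd, and \<open>v\<close> can then be eliminated from the relations of the other generators
    after multiplying these by \<open>b'\<close>.\<close>
  define b' where "b' = b - 2 * c v"
  have b': "odd b'" "of_int b' * v = 2 * (\<Sum>y\<in>X. of_int (c y) * y)"
    using b insert.hyps by (auto simp: b'_def algebra_simps)
  have X0: "x = 0" if "x \<in> X" for x
  proof (rule insert.IH[OF that])
    fix x assume "x \<in> X"
    then obtain e d where e: "odd e" "of_int e * x = 2 * (\<Sum>y\<in>insert v X. of_int (d y) * y)"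
      using insert.prems(2)[of x] by blast
    have "of_int (b' * e) * x = of_int b' * (2 * (of_int (d v) * v + (\<Sum>y\<in>X. of_int (d y) * y)))"
      using e insert.hyps by simp
    also have "\<dots> = 2 * (of_int (d v) * (of_int b' * v) + (\<Sum>y\<in>X. of_int (b' * d y) * y))"
      by (simp add: algebra_simps sum_distrib_left)
    also have "\<dots> = 2 * (\<Sum>y\<in>X. of_int (b' * d y + 2 * d v * c y) * y)"
      unfolding b' by (simp add: algebra_simps sum_distrib_left sum.distrib)
    finally show "\<exists>b c. odd b \<and> of_int b * x = 2 * (\<Sum>y\<in>X. of_int (c y) * y)"
      using b' e by (intro exI[of _ "b' * e"] exI[of _ "\<lambda>y. b' * d y + 2 * d v * c y"]) auto
  qed
  then have "(\<Sum>y\<in>X. of_int (c y) * y) = 0" by (intro sum.neutral) auto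
  then have "of_int b' * v = 0" using b'(2) by simp
  then have "v = 0" using b'(1) by auto
  then show ?case using X0 insert.prems(1) by blast
qed simp

text \<open>The ring generated by the \<open>q\<close>th roots of unity, presented as the integer
  span of all of them. The coefficients need not be unique; what matters is a finite generating set
  to which the Nakayama argument applies.\<close>

definition cyclotomic_ints :: "nat \<Rightarrow> complex set"
  where "cyclotomic_ints q = range (\<lambda>c. \<Sum>y | y ^ q = 1. of_int (c y) * y)"

lemma cyclotomic_intsI:
  "x = (\<Sum>y | y ^ q = 1. of_int (c y) * y) \<Longrightarrow> x \<in> cyclotomic_ints q"
  unfolding cyclotomic_ints_def by (rule range_eqI[of _ _ c])

context
  fixes q :: nat
  assumes q: "q > 0"
begin

lemma cyclotomic_ints_add:
  assumes "x \<in> cyclotomic_ints q" "y \<in> cyclotomic_ints q"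
  shows "x + y \<in> cyclotomic_ints q"
proof -
  obtain c d where "x = (\<Sum>y | y ^ q = 1. of_int (c y) * y)" "y = (\<Sum>y | y ^ q = 1. of_int (d y) * y)"
    using assms by (auto simp: cyclotomic_ints_def)
  then have "x + y = (\<Sum>y | y ^ q = 1. of_int (c y + d y) * y)"
    by (simp add: sum.distrib algebra_simps)
  then show ?thesis by (rule cyclotomic_intsI)
qed

lemma cyclotomic_ints_of_int_mult:
  assumes "x \<in> cyclotomic_ints q"
  shows "of_int a * x \<in> cyclotomic_ints q"
proof -
  obtain c where "x = (\<Sum>y | y ^ q = 1. of_int (c y) * y)"
    using assms by (auto simp: cyclotomic_ints_def)
  then have "of_int a * x = (\<Sum>y | y ^ q = 1. of_int (a * c y) * y)"
    by (simp add: sum_distrib_left algebra_simps)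
  then show ?thesis by (rule cyclotomic_intsI)
qed

lemma cyclotomic_ints_0: "0 \<in> cyclotomic_ints q"
  unfolding cyclotomic_ints_def by (rule range_eqI[of _ _ "\<lambda>_. 0"]) simp

lemma cyclotomic_ints_sum:
  "(\<And>t. t \<in> T \<Longrightarrow> f t \<in> cyclotomic_ints q) \<Longrightarrow> (\<Sum>t\<in>T. f t) \<in> cyclotomic_ints q"
  by (induction T rule: infinite_finite_induct) (auto intro: cyclotomic_ints_add cyclotomic_ints_0)

lemma cyclotomic_ints_root:
  assumes "z ^ q = 1"
  shows "z \<in> cyclotomic_ints q"
proof -
  have "z = (\<Sum>y | y ^ q = 1. if y = z then y else 0)"
    using assms q by (simp add: finite_nth_roots)
  also have "\<dots> = (\<Sum>y | y ^ q = 1. of_int (if y = z then 1 else 0) * y)"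
    by (rule sum.cong) auto
  finally show ?thesis by (rule cyclotomic_intsI)
qed

lemma cyclotomic_ints_1: "1 \<in> cyclotomic_ints q"
  by (rule cyclotomic_ints_root) simp

lemma cyclotomic_ints_of_int: "of_int a \<in> cyclotomic_ints q"
  using cyclotomic_ints_of_int_mult[OF cyclotomic_ints_1, of a] by simp

lemma cyclotomic_ints_mult:
  assumes "x \<in> cyclotomic_ints q" "y \<in> cyclotomic_ints q"
  shows "x * y \<in> cyclotomic_ints q"
proof -
  obtain c d where "x = (\<Sum>y | y ^ q = 1. of_int (c y) * y)" "y = (\<Sum>y | y ^ q = 1. of_int (d y) * y)"
    using assms by (auto simp: cyclotomic_ints_def)
  then have "x * y = (\<Sum>u | u ^ q = 1. \<Sum>v | v ^ q = 1. of_int (c u * d v) * (u * v))"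
    by (simp add: sum_product algebra_simps)
  also have "\<dots> \<in> cyclotomic_ints q"
    by (intro cyclotomic_ints_sum cyclotomic_ints_of_int_mult cyclotomic_ints_root)
       (auto simp: power_mult_distrib)
  finally show ?thesis .
qed

lemma cyclotomic_ints_prod:
  "(\<And>t. t \<in> T \<Longrightarrow> f t \<in> cyclotomic_ints q) \<Longrightarrow> (\<Prod>t\<in>T. f t) \<in> cyclotomic_ints q"
  by (induction T rule: infinite_finite_induct) (auto intro: cyclotomic_ints_mult cyclotomic_ints_1)

text \<open>If \<open>a = 2 * x\<close>, then \<open>a * z = 2 * (x * z)\<close> for every root of
  unity \<open>z\<close>, so all generators are halvable up to an odd factor and hence 0, although 1
  is among them.\<close>

lemma odd_not_twice_cyclotomic_int:
  assumes "odd a" "x \<in> cyclotomic_ints q"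
  shows "of_int a \<noteq> 2 * x"
proof
  assume eq: "of_int a = 2 * x"
  have "\<exists>b c. odd b \<and> of_int b * z = 2 * (\<Sum>y | y ^ q = 1. of_int (c y) * y)" if "z ^ q = 1" for z :: complex
  proof -
    have "x * z \<in> cyclotomic_ints q"
      by (rule cyclotomic_ints_mult[OF assms(2) cyclotomic_ints_root[OF that]])
    then obtain c where "x * z = (\<Sum>y | y ^ q = 1. of_int (c y) * y)"
      unfolding cyclotomic_ints_def by blast
    then have "of_int a * z = 2 * (\<Sum>y | y ^ q = 1. of_int (c y) * y)" using eq by simp
    then show ?thesis using \<open>odd a\<close> by blast
  qed
  then have "(1::complex) = 0"
    using q by (intro halvable_generators_eq_0[of "{y. y ^ q = 1}"]) (auto simp: finite_nth_roots)
  then show False by simp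
qed

text \<open>With \<open>r = y / x\<close> the powers of \<open>r\<close> sum to 0, so
  \<open>q\<close> is the sum of the \<open>1 - r ^ i\<close>, each of which is divisible by
  \<open>1 - r\<close>.\<close>

lemma root_diff_dvd_order:
  assumes "x ^ q = 1" "y ^ q = 1" "x \<noteq> y"
  shows "\<exists>u \<in> cyclotomic_ints q. (x - y) * u = of_nat q"
proof -
  have nz: "x \<noteq> 0" using assms q by (auto simp: power_0_left split: if_splits)
  define r where "r = y / x"
  have r: "r ^ q = 1" "r \<noteq> 1" using assms nz by (auto simp: r_def power_divide)
  have xi: "(1 / x) ^ q = 1" using assms by (simp add: power_divide)
  have rj: "(r ^ j) ^ q = 1" for j using r by (metis power_mult mult.commute power_one)
  define u where "u = (\<Sum>i<q. \<Sum>j<i. r ^ j)"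
  have "(1 - r) * (\<Sum>i<q. r ^ i) = 0" using r by (simp add: one_diff_power_eq[symmetric])
  then have "(\<Sum>i<q. r ^ i) = 0" using r by simp
  then have "of_nat q = (\<Sum>i<q. 1 - r ^ i)" by (simp add: sum_subtractf)
  also have "\<dots> = (1 - r) * u" by (simp add: one_diff_power_eq u_def sum_distrib_left)
  also have "\<dots> = (x - y) * (1 / x * u)" using nz by (simp add: r_def field_simps)
  finally have "(x - y) * (1 / x * u) = of_nat q" by simp
  moreover have "1 / x * u \<in> cyclotomic_ints q"
    unfolding u_def by (intro cyclotomic_ints_mult cyclotomic_ints_sum cyclotomic_ints_root xi rj)
  ultimately show ?thesis by blast
qed

end

section \<open>Vandermonde products and permanents\<close>

definition pairs :: "nat \<Rightarrow> (nat \<times> nat) set"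
  where "pairs n = {(i, j). 1 \<le> i \<and> i < j \<and> j \<le> n}"

definition vandermonde :: "nat \<Rightarrow> (nat \<Rightarrow> complex) \<Rightarrow> complex"
  where "vandermonde n y = (\<Prod>(i, j)\<in>pairs n. y j - y i)"

text \<open>The Leibniz expansion of the determinant with entries \<open>y i ^ (j - 1)\<close>; the
  shift by 1 comes from indexing by \<open>{1..n}\<close>.\<close>

definition alternant :: "nat \<Rightarrow> (nat \<Rightarrow> complex) \<Rightarrow> complex"
  where "alternant n y = (\<Sum>\<sigma> | \<sigma> permutes {1..n}. of_int (sign \<sigma>) * (\<Prod>i\<in>{1..n}. y i ^ (\<sigma> i - 1)))"

lemma finite_pairs [simp]: "finite (pairs n)"
  by (rule finite_subset[of _ "{1..n} \<times> {1..n}"]) (auto simp: pairs_def)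

lemma prod_permutes:
  assumes "\<tau> permutes T"
  shows "(\<Prod>i\<in>T. f (\<tau> i)) = (\<Prod>i\<in>T. f i)"
  using prod.reindex_bij_betw[OF permutes_imp_bij[OF assms]] .

lemma alternant_permute:
  assumes \<tau>: "\<tau> permutes {1..n}"
  shows "alternant n (y \<circ> \<tau>) = of_int (sign \<tau>) * alternant n y"
proof -
  have "alternant n (y \<circ> \<tau>) = (\<Sum>\<sigma> | \<sigma> permutes {1..n}. of_int (sign (\<sigma> \<circ> \<tau>)) *
      (\<Prod>i\<in>{1..n}. (y \<circ> \<tau>) i ^ ((\<sigma> \<circ> \<tau>) i - 1)))"
    unfolding alternant_def by (rule sum_permutations_compose_right[OF \<tau>])
  also have "\<dots> = (\<Sum>\<sigma> | \<sigma> permutes {1..n}. of_int (sign \<tau>) *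
      (of_int (sign \<sigma>) * (\<Prod>i\<in>{1..n}. y i ^ (\<sigma> i - 1))))"
  proof (rule sum.cong[OF refl])
    fix \<sigma> assume "\<sigma> \<in> {\<sigma>. \<sigma> permutes {1..n}}"
    then have "sign (\<sigma> \<circ> \<tau>) = sign \<sigma> * sign \<tau>"
      using \<tau> by (auto intro!: sign_compose permutes_imp_permutation[of "{1..n}"])
    with prod_permutes[OF \<tau>, of "\<lambda>i. y i ^ (\<sigma> i - 1)"]
    show "of_int (sign (\<sigma> \<circ> \<tau>)) * (\<Prod>i\<in>{1..n}. (y \<circ> \<tau>) i ^ ((\<sigma> \<circ> \<tau>) i - 1)) =
      of_int (sign \<tau>) * (of_int (sign \<sigma>) * (\<Prod>i\<in>{1..n}. y i ^ (\<sigma> i - 1)))"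
      by simp
  qed
  finally show ?thesis by (simp add: alternant_def sum_distrib_left)
qed

lemma alternant_eq_0:
  assumes "a \<in> {1..n}" "b \<in> {1..n}" "a \<noteq> b" "y a = y b"
  shows "alternant n y = 0"
proof -
  have "y \<circ> transpose a b = y" using assms by (auto simp: transpose_def)
  with alternant_permute[OF permutes_swap_id[OF assms(1,2)], of y] assms(3) show ?thesis
    by (simp add: sign_swap_id)
qed

lemma pairs_Suc: "pairs (Suc n) = pairs n \<union> (\<lambda>i. (i, Suc n)) ` {1..n}"
  by (auto simp: pairs_def)

lemma vandermonde_Suc: "vandermonde (Suc n) y = vandermonde n y * (\<Prod>i\<in>{1..n}. y (Suc n) - y i)"
proof -
  have "(\<Prod>(i, j)\<in>(\<lambda>i. (i, Suc n)) ` {1..n}. y j - y i) = (\<Prod>i\<in>{1..n}. y (Suc n) - y i)"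
    by (subst prod.reindex) (auto simp: inj_on_def)
  moreover have "pairs n \<inter> (\<lambda>i. (i, Suc n)) ` {1..n} = {}" by (auto simp: pairs_def)
  ultimately show ?thesis unfolding vandermonde_def pairs_Suc
    by (subst prod.union_disjoint) auto
qed

lemma vandermonde_eq_0:
  assumes "a \<in> {1..n}" "b \<in> {1..n}" "a \<noteq> b" "y a = y b"
  shows "vandermonde n y = 0"
proof -
  have "(min a b, max a b) \<in> pairs n" using assms by (auto simp: pairs_def)
  moreover have "y (max a b) - y (min a b) = 0" using assms by (auto simp: max_def min_def)
  ultimately show ?thesis unfolding vandermonde_def
    by (intro prod_zero bexI[of _ "(min a b, max a b)"]) auto
qed

lemma permutes_Suc_fixed:
  "{\<sigma>. \<sigma> permutes {1..Suc n} \<and> \<sigma> (Suc n) = Suc n} = {\<sigma>. \<sigma> permutes {1..n}}"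
proof safe
  fix \<sigma> assume *: "\<sigma> permutes {1..Suc n}" and fixed: "\<sigma> (Suc n) = Suc n"
  show "\<sigma> permutes {1..n}"
    by (rule permutes_superset[OF *]) (use fixed in \<open>auto simp: le_Suc_eq\<close>)
next
  fix \<sigma> assume *: "\<sigma> permutes {1..n}"
  show "\<sigma> permutes {1..Suc n}" by (rule permutes_subset[OF *]) auto
  show "\<sigma> (Suc n) = Suc n" by (rule permutes_not_in[OF *]) auto
qed

text \<open>The Vandermonde determinant, by induction. As polynomials of degree at most
  \<open>n\<close> in the last variable, both sides vanish at the \<open>n\<close> earlier values
  and have the same coefficient of degree \<open>n\<close>. Repeated values are treated apart, since
  \<open>n\<close> distinct nodes are needed.\<close>

lemma alternant_eq_vandermonde: "alternant n y = vandermonde n y"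
proof (induction n)
  case 0
  have "pairs 0 = {}" by (auto simp: pairs_def)
  then show ?case by (simp add: alternant_def vandermonde_def)
next
  case (Suc n)
  show ?case
  proof (cases "inj_on y {1..n}")
    case False
    then obtain a b where "a \<in> {1..n}" "b \<in> {1..n}" "a \<noteq> b" "y a = y b"
      by (auto simp: inj_on_def)
    then show ?thesis by (simp add: alternant_eq_0[of a _ b] vandermonde_eq_0[of a _ b])
  next
    case True
    \<comment> \<open>The alternant with its last argument replaced by an indeterminate.\<close>
    define p where "p = (\<Sum>\<sigma> | \<sigma> permutes {1..Suc n}.
      monom (of_int (sign \<sigma>) * (\<Prod>i\<in>{1..n}. y i ^ (\<sigma> i - 1))) (\<sigma> (Suc n) - 1))"
    define r where "r = smult (alternant n y) (\<Prod>i\<in>{1..n}. [:- y i, 1:])"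
    have p_eval: "poly p t = alternant (Suc n) (y(Suc n := t))" for t
      by (simp add: p_def alternant_def poly_sum poly_monom mult.assoc)
    have range: "\<sigma> (Suc n) - 1 \<le> n" if "\<sigma> permutes {1..Suc n}" for \<sigma>
      using permutes_in_image[OF that, of "Suc n"] by auto
    have "p = r"
    proof (rule poly_eqI_degree_lead_coeff[where n = n and A = "y ` {1..n}"])
      show "degree p \<le> n" unfolding p_def
      proof (rule degree_sum_le)
        fix \<sigma> assume "\<sigma> \<in> {\<sigma>. \<sigma> permutes {1..Suc n}}"
        then show "degree (monom (of_int (sign \<sigma>) * (\<Prod>i\<in>{1..n}. y i ^ (\<sigma> i - 1))) (\<sigma> (Suc n) - 1)) \<le> n"
          by (intro order_trans[OF degree_monom_le] range) simp
      qed (simp add: finite_permutations)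
      have d: "degree (\<Prod>i\<in>{1..n}. [:- y i, 1:]) = n"
        by (simp add: degree_prod_eq_sum_degree)
      then show "degree r \<le> n" unfolding r_def by (metis degree_smult_le)
      show "n \<le> card (y ` {1..n})" using True by (simp add: card_image)
      have lc: "coeff (\<Prod>i\<in>{1..n}. [:- y i, 1:]) n = 1"
        using lead_coeff_prod[of "\<lambda>i. [:- y i, 1:]" "{1..n}"] d by simp
      have "coeff p n = (\<Sum>\<sigma> | \<sigma> permutes {1..Suc n}. if \<sigma> (Suc n) = Suc n then
          of_int (sign \<sigma>) * (\<Prod>i\<in>{1..n}. y i ^ (\<sigma> i - 1)) else 0)"
        unfolding p_def coeff_sum
      proof (intro sum.cong refl)
        fix \<sigma> assume "\<sigma> \<in> {\<sigma>. \<sigma> permutes {1..Suc n}}"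
        then have "\<sigma> (Suc n) \<in> {1..Suc n}" using permutes_in_image[of \<sigma> "{1..Suc n}" "Suc n"] by simp
        then have "\<sigma> (Suc n) - 1 = n \<longleftrightarrow> \<sigma> (Suc n) = Suc n" by auto
        then show "coeff (monom (of_int (sign \<sigma>) * (\<Prod>i\<in>{1..n}. y i ^ (\<sigma> i - 1))) (\<sigma> (Suc n) - 1)) n =
          (if \<sigma> (Suc n) = Suc n then of_int (sign \<sigma>) * (\<Prod>i\<in>{1..n}. y i ^ (\<sigma> i - 1)) else 0)"
          by simp
      qed
      \<comment> \<open>The top power arises only from permutations fixing \<open>Suc n\<close>,
        which are those of \<open>{1..n}\<close>.\<close>
      also have "\<dots> = (\<Sum>\<sigma> | \<sigma> permutes {1..Suc n} \<and> \<sigma> (Suc n) = Suc n.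
          of_int (sign \<sigma>) * (\<Prod>i\<in>{1..n}. y i ^ (\<sigma> i - 1)))"
        by (rule sum.mono_neutral_cong_right) (auto simp: finite_permutations)
      also have "\<dots> = coeff r n"
        unfolding permutes_Suc_fixed r_def coeff_smult lc alternant_def by simp
      finally show "coeff p n = coeff r n" .
    next
      fix z assume "z \<in> y ` {1..n}"
      then obtain a where a: "a \<in> {1..n}" "z = y a" by auto
      have "alternant (Suc n) (y(Suc n := z)) = 0"
        using a by (intro alternant_eq_0[of a _ "Suc n"]) auto
      moreover have "poly r z = 0" unfolding r_def using a by (auto simp: poly_prod intro!: prod_zero)
      ultimately show "poly p z = poly r z" by (simp add: p_eval)
    qed
    then have "alternant (Suc n) (y(Suc n := y (Suc n))) = poly r (y (Suc n))"
      by (metis p_eval)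
    then show ?thesis by (simp add: r_def poly_prod Suc.IH vandermonde_Suc)
  qed
qed

lemma vandermonde_permute:
  "\<tau> permutes {1..n} \<Longrightarrow> vandermonde n (y \<circ> \<tau>) = of_int (sign \<tau>) * vandermonde n y"
  by (metis alternant_permute alternant_eq_vandermonde)

text \<open>Were the permanent 0, the Vandermonde product of the roots would be twice a cyclotomic
  integer. Each of its factors divides \<open>q\<close>, so a power of the odd number
  \<open>q\<close> would be twice a cyclotomic integer too.\<close>

lemma permanent_roots_of_unity_nonzero:
  fixes \<zeta> :: "nat \<Rightarrow> complex"
  assumes "q > 0" "odd q" "\<And>i. i \<in> {1..n} \<Longrightarrow> \<zeta> i ^ q = 1" "inj_on \<zeta> {1..n}"
  shows "(\<Sum>\<sigma> | \<sigma> permutes {1..n}. \<Prod>i\<in>{1..n}. \<zeta> i ^ (\<sigma> i - 1)) \<noteq> 0"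
proof
  assume per: "(\<Sum>\<sigma> | \<sigma> permutes {1..n}. \<Prod>i\<in>{1..n}. \<zeta> i ^ (\<sigma> i - 1)) = 0"
  note closed = cyclotomic_ints_mult[OF \<open>q > 0\<close>] cyclotomic_ints_sum[OF \<open>q > 0\<close>]
    cyclotomic_ints_prod[OF \<open>q > 0\<close>] cyclotomic_ints_of_int[OF \<open>q > 0\<close>]
  have pow: "\<zeta> i ^ j \<in> cyclotomic_ints q" if "i \<in> {1..n}" for i j
    using assms(3)[OF that] by (intro cyclotomic_ints_root[OF \<open>q > 0\<close>]) (metis mult.commute power_mult power_one)
  \<comment> \<open>Half the difference of determinant and permanent:
    \<open>(sign \<sigma> - 1) div 2\<close> is exact, being 0 or -1.\<close>
  define \<beta> where "\<beta> = (\<Sum>\<sigma> | \<sigma> permutes {1..n}. of_int ((sign \<sigma> - 1) div 2) * (\<Prod>i\<in>{1..n}. \<zeta> i ^ (\<sigma> i - 1)))"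
  have \<beta>: "\<beta> \<in> cyclotomic_ints q" unfolding \<beta>_def by (intro closed pow)
  have "alternant n \<zeta> = alternant n \<zeta> - (\<Sum>\<sigma> | \<sigma> permutes {1..n}. \<Prod>i\<in>{1..n}. \<zeta> i ^ (\<sigma> i - 1))"
    using per by simp
  also have "\<dots> = 2 * \<beta>"
    unfolding alternant_def \<beta>_def sum_subtractf[symmetric] sum_distrib_left
    by (rule sum.cong) (auto simp: sign_def)
  finally have v: "vandermonde n \<zeta> = 2 * \<beta>" by (simp add: alternant_eq_vandermonde)
  have "\<exists>u. \<forall>p\<in>pairs n. u p \<in> cyclotomic_ints q \<and> (\<zeta> (snd p) - \<zeta> (fst p)) * u p = of_nat q"
  proof (intro bchoice ballI)
    fix p assume "p \<in> pairs n"
    then have "fst p \<in> {1..n}" "snd p \<in> {1..n}" "fst p \<noteq> snd p" by (auto simp: pairs_def)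
    moreover from this have "\<zeta> (snd p) \<noteq> \<zeta> (fst p)" using assms(4) by (metis inj_onD)
    ultimately show "\<exists>u. u \<in> cyclotomic_ints q \<and> (\<zeta> (snd p) - \<zeta> (fst p)) * u = of_nat q"
      using root_diff_dvd_order[OF \<open>q > 0\<close> assms(3) assms(3)] by blast
  qed
  then obtain u where u: "\<And>p. p \<in> pairs n \<Longrightarrow> u p \<in> cyclotomic_ints q"
    "\<And>p. p \<in> pairs n \<Longrightarrow> (\<zeta> (snd p) - \<zeta> (fst p)) * u p = of_nat q" by blast
  have "vandermonde n \<zeta> * (\<Prod>p\<in>pairs n. u p) = (\<Prod>p\<in>pairs n. (\<zeta> (snd p) - \<zeta> (fst p)) * u p)"
    by (simp add: vandermonde_def prod.distrib case_prod_unfold)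
  also have "\<dots> = of_int (int q ^ card (pairs n))" using u(2) by simp
  finally have "of_int (int q ^ card (pairs n)) = 2 * (\<beta> * (\<Prod>p\<in>pairs n. u p))"
    using v by (simp add: mult.assoc)
  moreover have "\<beta> * (\<Prod>p\<in>pairs n. u p) \<in> cyclotomic_ints q" using u \<beta> by (intro closed) auto
  moreover have "odd (int q ^ card (pairs n))" using \<open>odd q\<close> by simp
  ultimately show False using odd_not_twice_cyclotomic_int[OF \<open>q > 0\<close>] by blast
qed

section \<open>Averages over the discrete torus\<close>

text \<open>Orthogonality of characters: for \<open>j \<noteq> K\<close>, multiplication by a
  suitable root \<omega> permutes the roots and scales the sum by a factor other than 1.\<close>

lemma sum_roots_of_unity_power:
  assumes "j < M" "K < M"
  shows "(\<Sum>z | z ^ M = 1. z ^ j * inverse z ^ K) = (if j = K then of_nat M else (0::complex))"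
proof (cases "j = K")
  case True
  have "z ^ K * inverse z ^ K = 1" if "z ^ M = 1" for z :: complex
    using that assms by (cases "z = 0") (auto simp: power_0_left power_inverse)
  then show ?thesis using True card_nth_roots[of 1 M] assms by simp
next
  case False
  define t where "t = (if j < K then K - j else j - K)"
  have t: "0 < t" "t < M" using False assms by (auto simp: t_def)
  \<comment> \<open>Since \<open>t < M\<close>, there are fewer \<open>t\<close>th roots of unity
    than \<open>M\<close>th roots.\<close>
  have "\<not> {z::complex. z ^ M = 1} \<subseteq> {z. z ^ t = 1}"
    using card_mono[OF finite_nth_roots[OF t(1), of 1], of "{z. z ^ M = 1}"] t
    by (auto simp: card_nth_roots)
  then obtain \<omega> :: complex where w: "\<omega> ^ M = 1" "\<omega> ^ t \<noteq> 1" by auto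
  then have w0: "\<omega> \<noteq> 0" using assms by (auto simp: power_0_left)
  define c where "c = \<omega> ^ j * inverse \<omega> ^ K"
  have "c \<noteq> 1"
  proof
    assume "c = 1"
    then have eq: "\<omega> ^ j = \<omega> ^ K" using w0 by (simp add: c_def power_inverse field_simps)
    have "\<omega> ^ max j K = \<omega> ^ min j K * \<omega> ^ t"
      unfolding power_add[symmetric] using False by (auto simp: t_def)
    then show False using eq w w0 by (auto simp: max_def min_def split: if_splits)
  qed
  have "bij_betw (\<lambda>z. \<omega> * z) {z. z ^ M = 1} {z. z ^ M = 1}"
    using w w0 by (intro bij_betwI[where g = "\<lambda>z. z / \<omega>"]) (auto simp: power_mult_distrib power_divide)
  from sum.reindex_bij_betw[OF this, of "\<lambda>z. z ^ j * inverse z ^ K"]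
  have "(\<Sum>z | z ^ M = 1. z ^ j * inverse z ^ K) = c * (\<Sum>z | z ^ M = 1. z ^ j * inverse z ^ K)"
    by (simp add: c_def power_mult_distrib sum_distrib_left algebra_simps)
  then show ?thesis using \<open>c \<noteq> 1\<close> False by simp
qed

text \<open>For \<open>K < M\<close> and a polynomial of degree below \<open>M\<close> in each
  variable, this is the coefficient of the monomial with all exponents \<open>K\<close> on
  \<open>I\<close>.\<close>

definition torus_sum :: "nat set \<Rightarrow> nat \<Rightarrow> nat \<Rightarrow> ((nat \<Rightarrow> complex) \<Rightarrow> complex) \<Rightarrow> complex"
  where "torus_sum I M K = grid_sum I (\<lambda>_. {z. z ^ M = 1}) (\<lambda>_ z. inverse z ^ K / of_nat M)"

lemma torus_leading_moments:
  assumes "K < M"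
  shows "leading_moments I K (\<lambda>_. {z. z ^ M = 1}) (\<lambda>_ z. inverse z ^ K / of_nat M)"
proof -
  have "(\<Sum>z | z ^ M = 1. inverse z ^ K / of_nat M * z ^ j) = (if j = K then 1 else (0::complex))"
    if "j \<le> K" for j
  proof -
    have "(\<Sum>z | z ^ M = 1. inverse z ^ K / of_nat M * z ^ j) =
        (\<Sum>z | z ^ M = 1. z ^ j * inverse z ^ K) / (of_nat M :: complex)"
      by (simp add: sum_divide_distrib mult.commute)
    also have "\<dots> = (if j = K then 1 else 0)"
      using assms that by (subst sum_roots_of_unity_power) auto
    finally show ?thesis .
  qed
  then show ?thesis using assms by (auto simp: leading_moments_def finite_nth_roots)
qed

text \<open>All variables share the same nodes and weights. This symmetry is what the torus offers
  and the original grid lacks.\<close>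

lemma torus_sum_permute:
  assumes \<tau>: "\<tau> permutes I"
  shows "torus_sum I M K (\<lambda>x. f (x \<circ> \<tau>)) = torus_sum I M K f"
proof -
  let ?U = "\<lambda>_::nat. {z::complex. z ^ M = 1}"
  have into: "x \<circ> \<rho> \<in> PiE I ?U" if "\<rho> permutes I" "x \<in> PiE I ?U" for \<rho> x
  proof (rule PiE_I)
    fix i assume "i \<in> I"
    then show "(x \<circ> \<rho>) i \<in> ?U i" using that permutes_in_image[OF that(1), of i] PiE_mem[OF that(2)] by auto
  next
    fix i assume "i \<notin> I"
    then show "(x \<circ> \<rho>) i = undefined"
      using that permutes_not_in[OF that(1)] PiE_arb[OF that(2)] by auto
  qed
  have "bij_betw (\<lambda>x. x \<circ> \<tau>) (PiE I ?U) (PiE I ?U)"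
    using into[OF \<tau>] into[OF permutes_inv[OF \<tau>]] permutes_inv_o[OF \<tau>]
    by (intro bij_betwI[where g = "\<lambda>x. x \<circ> inv \<tau>"]) (auto simp: comp_assoc)
  from sum.reindex_bij_betw[OF this, of "\<lambda>x. (\<Prod>i\<in>I. inverse (x i) ^ K / of_nat M) * f x"]
  show ?thesis
    using prod_permutes[OF \<tau>, of "\<lambda>i. inverse (x i) ^ K / of_nat M" for x :: "nat \<Rightarrow> complex"]
    by (simp add: torus_sum_def grid_sum_def)
qed

lemma sum_PiE_remove:
  assumes "b \<in> I"
  shows "(\<Sum>x\<in>PiE I A. F x) = (\<Sum>x\<in>PiE (I - {b}) A. \<Sum>z\<in>A b. F (x(b := z)))"
proof -
  have "PiE I A = (\<lambda>(z, x). x(b := z)) ` (A b \<times> PiE (I - {b}) A)"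
    using PiE_insert_eq[of b "I - {b}" A] assms by (simp add: insert_absorb)
  then have "(\<Sum>x\<in>PiE I A. F x) = (\<Sum>(z, x)\<in>A b \<times> PiE (I - {b}) A. F (x(b := z)))"
    by (subst \<open>PiE I A = _\<close>, subst sum.reindex[OF inj_combinator]) (auto simp: case_prod_unfold)
  also have "\<dots> = (\<Sum>z\<in>A b. \<Sum>x\<in>PiE (I - {b}) A. F (x(b := z)))"
    by (simp add: sum.cartesian_product)
  finally show ?thesis by (subst sum.swap)
qed

text \<open>Discrete integration by parts: the operator \<open>z d/dz\<close> multiplies
  \<open>z ^ j\<close> by \<open>j\<close>, and the average keeps only \<open>j = K\<close>. The
  degree bound excludes exponents that agree with \<open>K\<close> modulo \<open>M\<close> without
  being equal to it.\<close>

lemma euler_operator_roots_of_unity: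
  assumes "degree p < M" "K < M"
  shows "(\<Sum>z | z ^ M = 1. inverse z ^ K * (z * poly (pderiv p) z)) =
    of_nat K * (\<Sum>z | z ^ M = 1. inverse z ^ K * poly p (z::complex))"
proof -
  let ?s = "\<lambda>j. \<Sum>z | z ^ M = 1. z ^ j * inverse z ^ K :: complex"
  have euler: "z * poly (pderiv p) z = (\<Sum>j\<le>degree p. of_nat j * coeff p j * z ^ j)" for z
  proof -
    have "z * poly (pderiv p) z = poly (pCons 0 (pderiv p)) z" by simp
    also have "\<dots> = (\<Sum>j\<le>degree p. coeff (pCons 0 (pderiv p)) j * z ^ j)"
      unfolding poly_altdef
      by (rule sum.mono_neutral_left)
        (auto simp: coeff_eq_0 degree_pCons_eq_if degree_pderiv pderiv_eq_0_iff)
    also have "\<dots> = (\<Sum>j\<le>degree p. of_nat j * coeff p j * z ^ j)"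
      by (intro sum.cong refl) (auto simp: coeff_pCons coeff_pderiv split: nat.splits)
    finally show ?thesis .
  qed
  have "(\<Sum>z | z ^ M = 1. inverse z ^ K * (z * poly (pderiv p) z)) =
    (\<Sum>j\<le>degree p. of_nat j * coeff p j * ?s j)"
    unfolding euler sum_distrib_left by (subst sum.swap) (simp add: algebra_simps)
  also have "\<dots> = (\<Sum>j\<le>degree p. of_nat K * (coeff p j * ?s j))"
    using assms by (intro sum.cong refl) (auto simp: sum_roots_of_unity_power)
  also have "\<dots> = of_nat K * (\<Sum>z | z ^ M = 1. inverse z ^ K * poly p z)"
    unfolding poly_altdef sum_distrib_left by (subst sum.swap) (simp add: algebra_simps)
  finally show ?thesis .
qed

text \<open>The same in the variable \<open>b\<close> alone: \<open>p x\<close> is a polynomial in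
  that variable whose coefficients depend on the other coordinates only, as \<open>indep\<close>
  expresses.\<close>

lemma torus_sum_euler:
  assumes "finite I" "b \<in> I" "K < M" "\<And>x. degree (p x) < M"
    and indep: "\<And>x z. p (x(b := z)) = p x"
  shows "torus_sum I M K (\<lambda>x. x b * poly (pderiv (p x)) (x b)) =
    of_nat K * torus_sum I M K (\<lambda>x. poly (p x) (x b))"
proof -
  let ?U = "\<lambda>_::nat. {z::complex. z ^ M = 1}"
  define W where "W x = (\<Prod>i\<in>I - {b}. inverse (x i) ^ K / of_nat M) / (of_nat M :: complex)" for x
  have split: "torus_sum I M K f = (\<Sum>x\<in>PiE (I - {b}) ?U. W x * (\<Sum>z | z ^ M = 1. inverse z ^ K * f (x(b := z))))"
    for f
  proof -
    have *: "(\<Prod>i\<in>I. inverse ((x(b := z)) i) ^ K / of_nat M) = W x * inverse z ^ K" for x z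
      using assms(1,2) by (simp add: prod.remove W_def)
    show ?thesis unfolding torus_sum_def grid_sum_def
      by (subst sum_PiE_remove[OF assms(2)]) (simp only: * sum_distrib_left mult.assoc)
  qed
  show ?thesis
    unfolding split sum_distrib_left[of "of_nat K"]
    using euler_operator_roots_of_unity[OF assms(4,3)]
    by (intro sum.cong refl) (simp add: indep)
qed

text \<open>The square of the Vandermonde product up to sign. Taking all ordered pairs makes it
  symmetric and meaningful for any finite index set, so variables can be split off or permuted
  without tracking signs.\<close>

definition disc :: "nat set \<Rightarrow> (nat \<Rightarrow> complex) \<Rightarrow> complex"
  where "disc I x = (\<Prod>i\<in>I. \<Prod>j\<in>I. if i = j then 1 else x i - x j)"

lemma prod_square_insert:
  fixes g :: "nat \<Rightarrow> nat \<Rightarrow> complex"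
  assumes "finite I" "b \<notin> I" "g b b = 1"
  shows "(\<Prod>i\<in>insert b I. \<Prod>j\<in>insert b I. g i j) = (\<Prod>i\<in>I. \<Prod>j\<in>I. g i j) * (\<Prod>j\<in>I. g b j * g j b)"
  using assms by (simp add: prod.distrib)

lemma disc_insert:
  assumes "finite I" "b \<notin> I"
  shows "disc (insert b I) x = disc I x * (\<Prod>j\<in>I. - ((x b - x j)\<^sup>2))"
proof -
  have "(\<Prod>j\<in>I. (if b = j then 1 else x b - x j) * (if j = b then 1 else x j - x b)) =
     (\<Prod>j\<in>I. - ((x b - x j)\<^sup>2))"
    using assms by (intro prod.cong refl) (auto simp: power2_eq_square algebra_simps)
  then show ?thesis unfolding disc_def
    using assms by (subst prod_square_insert) auto
qed

lemma disc_permute: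
  assumes "\<tau> permutes I"
  shows "disc I (x \<circ> \<tau>) = disc I x"
proof -
  have inj: "\<tau> i = \<tau> j \<longleftrightarrow> i = j" for i j using permutes_inj[OF assms] by (auto dest: injD)
  have "disc I (x \<circ> \<tau>) = (\<Prod>i\<in>I. \<Prod>j\<in>I. if \<tau> i = \<tau> j then 1 else x (\<tau> i) - x (\<tau> j))"
    unfolding disc_def o_def inj ..
  also have "\<dots> = disc I x"
    unfolding disc_def
    by (subst prod_permutes[OF assms, of "\<lambda>j. if \<tau> i = j then 1 else x (\<tau> i) - x j" for i])
       (rule prod_permutes[OF assms, of "\<lambda>i. \<Prod>j\<in>I. if i = j then 1 else x i - x j"])
  finally show ?thesis .
qed

lemma disc_eq_0:
  assumes "finite I" "i \<in> I" "j \<in> I" "i \<noteq> j" "x i = x j"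
  shows "disc I x = 0"
proof -
  have "(\<Prod>j\<in>I. if i = j then 1 else x i - x j) = 0"
    using assms by (intro prod_zero) auto
  then show ?thesis unfolding disc_def using assms by (intro prod_zero) auto
qed

lemma disc_eq_vandermonde_square:
  "\<exists>c. c \<noteq> 0 \<and> (\<forall>x. disc {1..n} x = c * (vandermonde n x)\<^sup>2)"
proof (induction n)
  case 0
  have "pairs 0 = {}" by (auto simp: pairs_def)
  then show ?case by (intro exI[of _ 1]) (simp add: disc_def vandermonde_def)
next
  case (Suc n)
  then obtain c where c: "c \<noteq> 0" "\<And>x. disc {1..n} x = c * (vandermonde n x)\<^sup>2" by blast
  have "disc {1..Suc n} x = (c * (-1) ^ n) * (vandermonde (Suc n) x)\<^sup>2" for x
  proof -
    have "disc {1..Suc n} x = disc {1..n} x * (\<Prod>j\<in>{1..n}. - ((x (Suc n) - x j)\<^sup>2))"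
      using disc_insert[of "{1..n}" "Suc n" x] by (simp add: atLeastAtMostSuc_conv)
    also have "(\<Prod>j\<in>{1..n}. - ((x (Suc n) - x j)\<^sup>2)) = (-1) ^ n * (\<Prod>j\<in>{1..n}. x (Suc n) - x j)\<^sup>2"
      by (simp add: prod_uminus prod_power_distrib)
    finally show ?thesis unfolding c(2) by (simp add: vandermonde_Suc power_mult_distrib)
  qed
  with c show ?case by (intro exI[of _ "c * (-1) ^ n"]) auto
qed

section \<open>Aomoto's recurrence\<close>

text \<open>Aomoto's integrand of Selberg type. The set \<open>B\<close> grows from
  \<open>{}\<close> to \<open>I\<close>, where the extra factor amounts to lowering the exponent
  \<open>K\<close> by one.\<close>

definition aomoto :: "nat set \<Rightarrow> nat \<Rightarrow> nat set \<Rightarrow> nat \<Rightarrow> (nat \<Rightarrow> complex) \<Rightarrow> complex"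
  where "aomoto I m B L x = (\<Prod>i\<in>B. x i) * disc I x ^ m * (\<Sum>i\<in>I. x i) ^ L"

lemma pderiv_prod_linear_power:
  fixes y :: "nat \<Rightarrow> complex"
  assumes "finite J" "e \<ge> 2"
  shows "poly (pderiv (\<Prod>j\<in>J. [:- y j, 1:] ^ e)) t =
    (\<Sum>j\<in>J. of_nat e * ((\<Prod>j\<in>J. (t - y j) ^ e) / (t - y j)))"
proof -
  have "poly (pderiv (\<Prod>j\<in>J. [:- y j, 1:] ^ e)) t =
    (\<Sum>a\<in>J. (\<Prod>j\<in>J - {a}. (t - y j) ^ e) * (of_nat e * (t - y a) ^ (e - 1)))"
    by (simp add: pderiv_prod poly_sum poly_prod pderiv_power pderiv_pCons mult_ac)
  also have "\<dots> = (\<Sum>j\<in>J. of_nat e * ((\<Prod>j\<in>J. (t - y j) ^ e) / (t - y j)))"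
  proof (intro sum.cong refl)
    fix a assume a: "a \<in> J"
    \<comment> \<open>At \<open>t = y a\<close> both sides are 0: the left one because
      \<open>e - 1 > 0\<close>, the right one by division by zero.\<close>
    have "(t - y a) ^ (e - 1) = (t - y a) ^ e / (t - y a)"
      using assms(2) by (cases "t = y a") (auto simp: power_diff)
    then show "(\<Prod>j\<in>J - {a}. (t - y j) ^ e) * (of_nat e * (t - y a) ^ (e - 1)) =
      of_nat e * ((\<Prod>j\<in>J. (t - y j) ^ e) / (t - y a))"
      using a assms(1) by (simp add: prod.remove[of J a] algebra_simps)
  qed
  finally show ?thesis .
qed

lemma disc_power_remove:
  assumes "finite I" "b \<in> I"
  shows "disc I x ^ m = (disc (I - {b}) x * (-1) ^ card (I - {b})) ^ m * (\<Prod>j\<in>I - {b}. (x b - x j) ^ (2 * m))"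
proof -
  have "disc I x = disc (I - {b}) x * (\<Prod>j\<in>I - {b}. - ((x b - x j)\<^sup>2))"
    using disc_insert[of "I - {b}" b x] assms by (simp add: insert_absorb)
  then show ?thesis
    by (simp add: prod_uminus power_mult_distrib power_mult prod_power_distrib[symmetric] mult.assoc)
qed

text \<open>
  In the last sum the division by zero is harmless: it only occurs where the discriminant vanishes,
  and so does the polynomial that the quotient stands for.
\<close>

lemma aomoto_integration_by_parts:
  assumes I: "finite I" "b \<in> I" and B: "b \<notin> B" "finite B" and m: "m > 0"
    and M: "K < M" "2 * m * card I + L < M"
  shows "of_nat K * torus_sum I M K (aomoto I m B L) =
    of_nat L * torus_sum I M K (aomoto I m (insert b B) (L - 1)) +
    (\<Sum>j\<in>I - {b}. of_nat (2 * m) * torus_sum I M K (\<lambda>x. aomoto I m B L x * (x b / (x b - x j))))"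
proof -
  define J where "J = I - {b}"
  have J: "finite J" "b \<notin> J" using I by (auto simp: J_def)
  have sum_b: "(\<Sum>i\<in>I. x i) = x b + (\<Sum>i\<in>J. x i)" for x :: "nat \<Rightarrow> complex"
    using I by (simp add: J_def sum.remove)
  \<comment> \<open>The integrand is written as a polynomial \<open>p x\<close> in
    \<open>x b\<close>: \<open>c x\<close> collects the factors free of \<open>x b\<close>, and
    \<open>Q x\<close> holds the factors of the discriminant that involve it.\<close>
  define c where "c x = (\<Prod>i\<in>B. x i) * (disc J x * (-1) ^ card J) ^ m" for x
  define Q where "Q x = (\<Prod>j\<in>J. [:- x j, 1:] ^ (2 * m))" for x :: "nat \<Rightarrow> complex"
  define p where "p x = smult (c x) (Q x * [:\<Sum>i\<in>J. x i, 1:] ^ L)" for x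
  have polyQ: "poly (Q x) (x b) = (\<Prod>j\<in>J. (x b - x j) ^ (2 * m))" for x
    by (simp add: Q_def poly_prod)
  have cQ: "c x * (\<Prod>j\<in>J. (x b - x j) ^ (2 * m)) = (\<Prod>i\<in>B. x i) * disc I x ^ m" for x
    using disc_power_remove[OF I, of x m] by (simp add: c_def J_def)
  have poly_p: "poly (p x) (x b) = aomoto I m B L x" for x
    using cQ[of x] by (simp add: p_def polyQ aomoto_def sum_b add.commute mult.assoc[symmetric])
  \<comment> \<open>The derivative of the power of the sum gives the first term, where
    \<open>x b\<close> joins the product over \<open>B\<close>; for \<open>L = 0\<close> the
    truncated exponent \<open>L - 1\<close> is harmless because of the factor
    \<open>of_nat L\<close>. The derivative of \<open>Q x\<close> gives the other terms.\<close>
  have deriv: "x b * poly (pderiv (p x)) (x b) = of_nat L * aomoto I m (insert b B) (L - 1) x +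
    (\<Sum>j\<in>J. of_nat (2 * m) * (aomoto I m B L x * (x b / (x b - x j))))" (is "?l = ?r") for x
  proof -
    define e where "e = (\<Sum>i\<in>I. x i)"
    define P where "P = (\<Prod>j\<in>J. (x b - x j) ^ (2 * m))"
    have dQ: "poly (pderiv (Q x)) (x b) = (\<Sum>j\<in>J. of_nat (2 * m) * (P / (x b - x j)))"
      unfolding Q_def P_def using J m by (intro pderiv_prod_linear_power) auto
    have "?l = of_nat L * (x b * (c x * P) * e ^ (L - 1)) + x b * c x * e ^ L * poly (pderiv (Q x)) (x b)"
      by (simp add: p_def pderiv_smult pderiv_mult pderiv_power pderiv_pCons polyQ P_def e_def sum_b algebra_simps)
    also have "x b * c x * e ^ L * poly (pderiv (Q x)) (x b) =
      (\<Sum>j\<in>J. of_nat (2 * m) * (c x * P * e ^ L * (x b / (x b - x j))))"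
      unfolding dQ by (simp add: sum_distrib_left algebra_simps)
    finally show ?thesis
      unfolding P_def cQ using B by (simp add: aomoto_def e_def algebra_simps)
  qed
  have "torus_sum I M K (\<lambda>x. x b * poly (pderiv (p x)) (x b)) =
    of_nat K * torus_sum I M K (\<lambda>x. poly (p x) (x b))"
  proof (rule torus_sum_euler[OF I M(1)])
    fix x :: "nat \<Rightarrow> complex" and z
    have "disc J (x(b := z)) = disc J x"
      unfolding disc_def using J by (intro prod.cong refl) auto
    moreover have "(\<Prod>i\<in>B. (x(b := z)) i) = (\<Prod>i\<in>B. x i)" using B by (intro prod.cong) auto
    moreover have "(\<Sum>i\<in>J. (x(b := z)) i) = (\<Sum>i\<in>J. x i)" using J by (intro sum.cong) auto
    moreover have "Q (x(b := z)) = Q x" unfolding Q_def using J by (intro prod.cong) auto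
    ultimately show "p (x(b := z)) = p x" by (simp add: p_def c_def)
  next
    fix x :: "nat \<Rightarrow> complex"
    have "degree (Q x) \<le> (\<Sum>j\<in>J. 2 * m)" unfolding Q_def
      by (rule order_trans[OF degree_prod_sum_le[OF J(1)]])
         (intro sum_mono, simp, rule order_trans[OF degree_power_le], simp)
    also have "\<dots> \<le> 2 * m * card I" using I by (simp add: J_def card_Diff_subset)
    finally have "degree (Q x) \<le> 2 * m * card I" .
    moreover have "degree ([:\<Sum>i\<in>J. x i, 1:] ^ L) \<le> L"
      by (rule order_trans[OF degree_power_le]) simp
    ultimately have "degree (p x) \<le> 2 * m * card I + L" unfolding p_def
      by (intro order_trans[OF degree_smult_le] order_trans[OF degree_mult_le] add_mono)
    then show "degree (p x) < M" using M(2) by simp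
  qed
  then show ?thesis
    unfolding deriv poly_p torus_sum_def grid_sum_add grid_sum_sum grid_sum_cmult J_def by (rule sym)
qed

lemma aomoto_permute:
  assumes "\<tau> permutes I" "\<tau> permutes B"
  shows "aomoto I m B L (x \<circ> \<tau>) = aomoto I m B L x"
  using prod_permutes[OF assms(2), of x] disc_permute[OF assms(1), of x]
    sum.reindex_bij_betw[OF permutes_imp_bij[OF assms(1)], of x]
  by (simp add: aomoto_def)

text \<open>For \<open>j\<close> in \<open>B\<close> the numerator contains both \<open>x b\<close>
  and \<open>x j\<close> and is symmetric in them, while \<open>x b - x j\<close> changes sign under
  the swap. The average therefore equals its own negative.\<close>

lemma torus_sum_aomoto_quotient_inside:
  assumes "finite I" "B \<subseteq> I" "b \<in> I" "b \<notin> B" "j \<in> B"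
  shows "torus_sum I M K (\<lambda>x. aomoto I m B L x * (x b / (x b - x j))) = 0"
proof -
  let ?h = "\<lambda>x. aomoto I m (insert b B) L x / (x b - x j)"
  let ?\<tau> = "transpose b j"
  have \<tau>: "?\<tau> permutes I" "?\<tau> permutes insert b B"
    using assms by (auto intro!: permutes_swap_id)
  have fin: "finite B" using assms by (auto intro: finite_subset)
  have "?h (x \<circ> ?\<tau>) = - 1 * ?h x" for x
    unfolding aomoto_permute[OF \<tau>] using minus_divide_right[of _ "x b - x j"] by simp
  with torus_sum_permute[OF \<tau>(1), of M K ?h]
  have "torus_sum I M K ?h = - 1 * torus_sum I M K ?h"
    unfolding torus_sum_def grid_sum_cmult[symmetric] by simp
  then have "torus_sum I M K ?h = 0" by simp
  moreover have "?h = (\<lambda>x. aomoto I m B L x * (x b / (x b - x j)))"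
    using assms fin by (auto simp: aomoto_def)
  ultimately show ?thesis by simp
qed

text \<open>For \<open>j\<close> outside \<open>B\<close> the swap of \<open>b\<close> and
  \<open>j\<close> fixes the integrand, and the quotient and its image add up to 1.\<close>

lemma torus_sum_aomoto_quotient_outside:
  assumes "finite I" "B \<subseteq> I" "b \<in> I" "b \<notin> B" "j \<in> I" "j \<notin> B" "j \<noteq> b" "m > 0"
  shows "2 * torus_sum I M K (\<lambda>x. aomoto I m B L x * (x b / (x b - x j))) =
    torus_sum I M K (aomoto I m B L)"
proof -
  let ?h = "\<lambda>x. aomoto I m B L x * (x b / (x b - x j))"
  let ?\<tau> = "transpose b j"
  have \<tau>: "?\<tau> permutes I" using assms by (auto intro!: permutes_swap_id)
  have "aomoto I m B L (x \<circ> ?\<tau>) = aomoto I m B L x" for x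
  proof -
    have "(\<Prod>i\<in>B. (x \<circ> ?\<tau>) i) = (\<Prod>i\<in>B. x i)"
      using assms by (intro prod.cong refl) (auto simp: transpose_def)
    then show ?thesis
      using disc_permute[OF \<tau>, of x] sum.reindex_bij_betw[OF permutes_imp_bij[OF \<tau>], of x]
      by (simp add: aomoto_def)
  qed
  then have "?h x + ?h (x \<circ> ?\<tau>) = aomoto I m B L x" for x
  proof (cases "x b = x j")
    \<comment> \<open>The quotients take the default value 0 here, and the right side is 0 too
      because the discriminant vanishes and \<open>m > 0\<close>.\<close>
    case True
    then show ?thesis using disc_eq_0[of I b j x] assms by (simp add: aomoto_def)
  next
    case False
    have "x j / (x j - x b) = - (x j / (x b - x j))"
      by (metis minus_diff_eq minus_divide_right)
    then have "x b / (x b - x j) + x j / (x j - x b) = 1"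
      using False diff_divide_distrib[of "x b" "x j" "x b - x j"] by simp
    with \<open>\<And>x. aomoto I m B L (x \<circ> ?\<tau>) = aomoto I m B L x\<close> show ?thesis
      by (simp del: times_divide_eq_right flip: distrib_left)
  qed
  then have "torus_sum I M K (aomoto I m B L) = torus_sum I M K ?h + torus_sum I M K (\<lambda>x. ?h (x \<circ> ?\<tau>))"
    unfolding torus_sum_def grid_sum_add[symmetric] by presburger
  also have "torus_sum I M K (\<lambda>x. ?h (x \<circ> ?\<tau>)) = torus_sum I M K ?h"
    by (rule torus_sum_permute[OF \<tau>])
  finally show ?thesis by simp
qed

text \<open>In the integration by parts, indices in \<open>B\<close> contribute nothing, and each
  index outside \<open>insert b B\<close> contributes \<open>2 * m\<close> times one half of the
  same average; these terms are moved to the left.\<close>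

lemma aomoto_recurrence:
  assumes I: "finite I" "b \<in> I" "B \<subseteq> I" "b \<notin> B" and m: "m > 0"
    and M: "K < M" "2 * m * card I + L < M"
  shows "(of_nat K - of_nat (m * card (I - insert b B))) * torus_sum I M K (aomoto I m B L) =
    of_nat L * torus_sum I M K (aomoto I m (insert b B) (L - 1))"
proof -
  let ?T = "torus_sum I M K"
  have fin: "finite B" using I by (auto intro: finite_subset)
  have "(\<Sum>j\<in>I - {b}. of_nat (2 * m) * ?T (\<lambda>x. aomoto I m B L x * (x b / (x b - x j)))) =
    (\<Sum>j\<in>I - insert b B. of_nat (2 * m) * ?T (\<lambda>x. aomoto I m B L x * (x b / (x b - x j))))"
    using I torus_sum_aomoto_quotient_inside[OF I(1,3,2,4)]
    by (intro sum.mono_neutral_right) auto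
  also have "\<dots> = (\<Sum>j\<in>I - insert b B. of_nat m * ?T (aomoto I m B L))"
    using torus_sum_aomoto_quotient_outside[OF I(1,3,2,4) _ _ _ m, of _ M K L]
    by (intro sum.cong refl) (simp add: mult.commute[of 2] mult.assoc)
  also have "\<dots> = of_nat (m * card (I - insert b B)) * ?T (aomoto I m B L)" by simp
  finally show ?thesis
    using aomoto_integration_by_parts[OF I(1,2,4) fin m M] by (simp add: algebra_simps)
qed

lemma torus_sum_aomoto_full:
  assumes "finite I" "K > 0" "K < M"
  shows "torus_sum I M K (aomoto I m I L) = torus_sum I M (K - 1) (aomoto I m {} L)"
  unfolding torus_sum_def grid_sum_def
proof (rule sum.cong[OF refl])
  fix x assume x: "x \<in> I \<rightarrow>\<^sub>E {z::complex. z ^ M = 1}"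
  have "inverse (x i) ^ K / of_nat M * x i = inverse (x i) ^ (K - 1) / of_nat M" if "i \<in> I" for i
  proof -
    have "x i \<noteq> 0" using PiE_mem[OF x that] assms by (auto simp: power_0_left)
    then show ?thesis using assms by (cases K) auto
  qed
  then have "(\<Prod>i\<in>I. inverse (x i) ^ K / of_nat M) * (\<Prod>i\<in>I. x i) = (\<Prod>i\<in>I. inverse (x i) ^ (K - 1) / of_nat M)"
    unfolding prod.distrib[symmetric] by (intro prod.cong refl) simp
  then show "(\<Prod>i\<in>I. inverse (x i) ^ K / of_nat M) * aomoto I m I L x =
    (\<Prod>i\<in>I. inverse (x i) ^ (K - 1) / of_nat M) * aomoto I m {} L x"
    by (simp add: aomoto_def mult.assoc[symmetric])
qed

text \<open>On the unit circle inversion is conjugation, so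
  \<open>- ((x b - x j)\<^sup>2) / (x b * x j)\<close> is the squared modulus of
  \<open>x b - x j\<close>. Each variable occurs in \<open>card I - 1\<close> pairs.\<close>

lemma unit_circle_disc_eq_norm:
  assumes "finite I" "\<And>i. i \<in> I \<Longrightarrow> cmod (x i) = 1"
  shows "disc I x / (\<Prod>i\<in>I. x i) ^ (card I - 1) = of_real (cmod (disc I x))"
  using assms
proof (induction I rule: finite_induct)
  case empty
  then show ?case by (simp add: disc_def)
next
  case (insert b I)
  let ?P = "\<Prod>i\<in>I. x i"
  have pair: "- ((x b - x j)\<^sup>2) / (x b * x j) = of_real (cmod (- ((x b - x j)\<^sup>2)))" if "j \<in> I" for j
  proof -
    have inv: "inverse (x b) = cnj (x b)" "inverse (x j) = cnj (x j)"
      using insert.prems that complex_norm_square[of "x b"] complex_norm_square[of "x j"]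
      by (auto intro!: inverse_unique)
    have nz: "x b \<noteq> 0" "x j \<noteq> 0" using insert.prems that by fastforce+
    then have "- ((x b - x j)\<^sup>2) / (x b * x j) = (x b - x j) * (inverse (x b) - inverse (x j))"
      by (simp add: field_simps power2_eq_square)
    also have "\<dots> = (x b - x j) * cnj (x b - x j)" using inv by simp
    also have "\<dots> = of_real (cmod (- ((x b - x j)\<^sup>2)))"
      using complex_norm_square[of "x b - x j"] by (simp add: norm_power)
    finally show ?thesis .
  qed
  have "(\<Prod>i\<in>insert b I. x i) ^ (card (insert b I) - 1) = ?P ^ (card I - 1) * (\<Prod>j\<in>I. x b * x j)"
    using insert.hyps by (cases "card I") (auto simp: prod.distrib power_mult_distrib)
  then have "disc (insert b I) x / (\<Prod>i\<in>insert b I. x i) ^ (card (insert b I) - 1) =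
    disc I x / ?P ^ (card I - 1) * (\<Prod>j\<in>I. - ((x b - x j)\<^sup>2) / (x b * x j))"
    by (simp only: disc_insert[OF insert.hyps] prod_dividef times_divide_times_eq)
  also have "\<dots> = of_real (cmod (disc I x)) * (\<Prod>j\<in>I. of_real (cmod (- ((x b - x j)\<^sup>2))))"
    using insert.IH insert.prems pair by simp
  also have "\<dots> = of_real (cmod (disc (insert b I) x))"
    using insert.hyps by (simp add: disc_insert norm_mult prod_norm[symmetric])
  finally show ?case .
qed

text \<open>All summands are nonnegative reals, and one is positive: \<open>card I \<le> M\<close>
  leaves room for a point with distinct coordinates.\<close>

lemma torus_sum_disc_power_nonzero:
  assumes I: "finite I" and M: "card I \<le> M" "0 < M"
  shows "torus_sum I M (m * (card I - 1)) (aomoto I m {} 0) \<noteq> 0"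
proof -
  let ?X = "PiE I (\<lambda>_. {z::complex. z ^ M = 1})"
  have summand: "(\<Prod>i\<in>I. inverse (x i) ^ (m * (card I - 1)) / of_nat M) * aomoto I m {} 0 x =
    of_real (cmod (disc I x) ^ m / of_nat M ^ card I)" if x: "x \<in> ?X" for x
  proof -
    have "cmod (x i) = 1" if "i \<in> I" for i
      using PiE_mem[OF x that] M by (auto dest: power_eq_1_iff)
    from unit_circle_disc_eq_norm[OF I this]
    have "disc I x ^ m / ((\<Prod>i\<in>I. x i) ^ (card I - 1)) ^ m = of_real (cmod (disc I x) ^ m)"
      unfolding power_divide[symmetric] by simp
    moreover have "(\<Prod>i\<in>I. inverse (x i) ^ (m * (card I - 1))) = 1 / ((\<Prod>i\<in>I. x i) ^ (card I - 1)) ^ m"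
    proof -
      have "(\<Prod>i\<in>I. inverse (x i) ^ (m * (card I - 1))) = (\<Prod>i\<in>I. 1 / (x i ^ (card I - 1)) ^ m)"
        by (intro prod.cong refl) (simp add: power_mult[symmetric] mult.commute power_inverse divide_inverse)
      then show ?thesis by (simp add: prod_dividef prod_power_distrib)
    qed
    ultimately have "(\<Prod>i\<in>I. inverse (x i) ^ (m * (card I - 1))) * disc I x ^ m = of_real (cmod (disc I x) ^ m)"
      by (simp only: mult_1_left times_divide_eq_left)
    then show ?thesis
      by (simp add: aomoto_def prod_dividef)
  qed
  obtain x0 where x0: "x0 ` I \<subseteq> {z::complex. z ^ M = 1}" "inj_on x0 I"
    using card_le_inj[OF I, of "{z::complex. z ^ M = 1}"] M by (auto simp: card_nth_roots finite_nth_roots)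
  define x1 where "x1 = restrict x0 I"
  have x1: "x1 \<in> ?X" "inj_on x1 I" using x0 by (auto simp: x1_def inj_on_def)
  have "disc I x1 \<noteq> 0"
    using x1(2) I by (auto simp: disc_def inj_on_def)
  then have pos: "0 < cmod (disc I x1) ^ m / real M ^ card I" using M by simp
  have fin: "finite ?X" using I M by (intro finite_PiE) (auto simp: finite_nth_roots)
  have "0 < (\<Sum>x\<in>?X. cmod (disc I x) ^ m / real M ^ card I)"
    using pos by (intro sum_pos2[OF fin x1(1)]) auto
  moreover have "torus_sum I M (m * (card I - 1)) (aomoto I m {} 0) =
    of_real (\<Sum>x\<in>?X. cmod (disc I x) ^ m / real M ^ card I)"
    unfolding torus_sum_def grid_sum_def of_real_sum by (rule sum.cong[OF refl]) (use summand in simp)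
  ultimately show ?thesis by (metis less_irrefl of_real_eq_0_iff)
qed

text \<open>Descent in \<open>d\<close>. If the average were 0, the recurrence would make it 0 for
  every \<open>B\<close>, since the factor \<open>?N - card B\<close> is nonzero as long as
  \<open>B\<close> is a proper subset. At \<open>B = I\<close> this contradicts the case
  \<open>d\<close>, with exponents \<open>?K - 1\<close> and \<open>card I * d\<close>.\<close>

lemma torus_sum_disc_power_sum_power_nonzero:
  assumes I: "finite I" "I \<noteq> {}" and m: "m > 0"
    and M: "d + m * (card I - 1) < M" "2 * m * card I + card I * d < M"
  shows "torus_sum I M (d + m * (card I - 1)) (aomoto I m {} (card I * d)) \<noteq> 0"
  using M
proof (induction d)
  case 0
  have "card I * 1 \<le> card I * (2 * m)" using m by (intro mult_le_mono2) simp
  also have "\<dots> < M" using 0 by (simp add: mult_ac)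
  finally show ?case using torus_sum_disc_power_nonzero[OF I(1), of M m] by (simp add: mult.commute)
next
  case (Suc d)
  let ?N = "card I * Suc d" and ?K = "Suc d + m * (card I - 1)"
  have "torus_sum I M ?K (aomoto I m B (?N - card B)) = 0"
    if zero: "torus_sum I M ?K (aomoto I m {} ?N) = 0" and B: "B \<subseteq> I" for B
    using finite_subset[OF B I(1)] B
  proof (induction B rule: finite_induct)
    case empty
    show ?case using zero by simp
  next
    case (insert b B)
    have "card B < card I"
      using insert I by (intro psubset_card_mono) auto
    also have "card I \<le> ?N" by simp
    finally have "of_nat (?N - card B) \<noteq> (0::complex)" unfolding of_nat_eq_0_iff by simp
    moreover have "of_nat (?N - card B) * torus_sum I M ?K (aomoto I m (insert b B) (?N - card B - 1)) = 0"
      using insert Suc.prems I m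
      by (subst aomoto_recurrence[symmetric]) auto
    ultimately have "torus_sum I M ?K (aomoto I m (insert b B) (?N - card B - 1)) = 0"
      unfolding mult_eq_0_iff by blast
    then show ?case using insert.hyps by simp
  qed
  from this[of I] torus_sum_aomoto_full[of I ?K M m "?N - card I"] Suc I show ?case by auto
qed

section \<open>The restricted sumset bound\<close>

text \<open>Expand the twisted Vandermonde product as an alternant. Permuting the variables back in
  the term of \<sigma> produces \<open>sign \<sigma>\<close> from the odd power
  \<open>2 * m - 1\<close>; it cancels the sign of the expansion, so the determinant becomes a
  permanent.\<close>

lemma torus_sum_twisted_vandermonde:
  assumes "m > 0"
  shows "torus_sum {1..n} M K (\<lambda>x. vandermonde n (\<lambda>i. \<zeta> i * x i) * vandermonde n x ^ (2 * m - 1) * (\<Sum>i\<in>{1..n}. x i) ^ N) =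
    (\<Sum>\<sigma> | \<sigma> permutes {1..n}. \<Prod>i\<in>{1..n}. \<zeta> i ^ (\<sigma> i - 1)) *
    torus_sum {1..n} M K (\<lambda>x. (\<Prod>i\<in>{1..n}. x i ^ (i - 1)) * vandermonde n x ^ (2 * m - 1) * (\<Sum>i\<in>{1..n}. x i) ^ N)"
proof -
  let ?T = "torus_sum {1..n} M K" and ?S = "{\<sigma>. \<sigma> permutes {1..n}}"
  define z where "z \<sigma> = (\<Prod>i\<in>{1..n}. \<zeta> i ^ (\<sigma> i - 1))" for \<sigma> :: "nat \<Rightarrow> nat"
  define F where "F \<sigma> x = (\<Prod>i\<in>{1..n}. x i ^ (\<sigma> i - 1)) * vandermonde n x ^ (2 * m - 1) * (\<Sum>i\<in>{1..n}. x i) ^ N"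
    for \<sigma> :: "nat \<Rightarrow> nat" and x
  have F_perm: "?T (F \<sigma>) = of_int (sign \<sigma>) * ?T (F id)" if \<sigma>: "\<sigma> permutes {1..n}" for \<sigma>
  proof -
    have s: "sign \<sigma> ^ (2 * m - 1) = sign \<sigma>" using assms by (auto simp: sign_def)
    have "F \<sigma> (x \<circ> \<sigma>) = of_int (sign \<sigma>) * F id x" for x
      using s prod_permutes[OF \<sigma>, of "\<lambda>i. x i ^ (i - 1)"]
        sum.reindex_bij_betw[OF permutes_imp_bij[OF \<sigma>], of x]
      by (simp add: F_def vandermonde_permute[OF \<sigma>] power_mult_distrib)
    then show ?thesis
      using torus_sum_permute[OF \<sigma>, of M K "F \<sigma>"] by (simp add: torus_sum_def grid_sum_cmult)
  qed
  have "vandermonde n (\<lambda>i. \<zeta> i * x i) * vandermonde n x ^ (2 * m - 1) * (\<Sum>i\<in>{1..n}. x i) ^ N =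
    (\<Sum>\<sigma>\<in>?S. of_int (sign \<sigma>) * z \<sigma> * F \<sigma> x)" for x
    unfolding alternant_eq_vandermonde[of n "\<lambda>i. \<zeta> i * x i", symmetric] alternant_def F_def z_def sum_distrib_right
    by (intro sum.cong refl) (simp add: power_mult_distrib prod.distrib mult_ac)
  then have "?T (\<lambda>x. vandermonde n (\<lambda>i. \<zeta> i * x i) * vandermonde n x ^ (2 * m - 1) * (\<Sum>i\<in>{1..n}. x i) ^ N) =
    (\<Sum>\<sigma>\<in>?S. of_int (sign \<sigma>) * z \<sigma> * ?T (F \<sigma>))"
    by (simp add: torus_sum_def grid_sum_sum grid_sum_cmult)
  also have "\<dots> = (\<Sum>\<sigma>\<in>?S. z \<sigma> * ?T (F id))"
  proof (intro sum.cong refl)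
    fix \<sigma> assume "\<sigma> \<in> ?S"
    then have "of_int (sign \<sigma>) * z \<sigma> * ?T (F \<sigma>) = of_int (sign \<sigma> * sign \<sigma>) * (z \<sigma> * ?T (F id))"
      using F_perm by (simp only: mem_Collect_eq of_int_mult mult_ac)
    then show "of_int (sign \<sigma>) * z \<sigma> * ?T (F \<sigma>) = z \<sigma> * ?T (F id)" by simp
  qed
  finally show ?thesis unfolding z_def F_def[abs_def] sum_distrib_right id_apply .
qed

lemma torus_sum_twisted_vandermonde_nonzero:
  assumes "n > 0" "m > 0" "q > 0" "odd q" "\<And>i. i \<in> {1..n} \<Longrightarrow> \<zeta> i ^ q = 1" "inj_on \<zeta> {1..n}"
    and M: "d + m * (n - 1) < M" "2 * m * n + n * d < M"
  shows "torus_sum {1..n} M (d + m * (n - 1))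
    (\<lambda>x. vandermonde n (\<lambda>i. \<zeta> i * x i) * vandermonde n x ^ (2 * m - 1) * (\<Sum>i\<in>{1..n}. x i) ^ (n * d)) \<noteq> 0"
proof -
  let ?T = "torus_sum {1..n} M (d + m * (n - 1))"
  let ?C = "?T (\<lambda>x. (\<Prod>i\<in>{1..n}. x i ^ (i - 1)) * vandermonde n x ^ (2 * m - 1) * (\<Sum>i\<in>{1..n}. x i) ^ (n * d))"
  obtain c where c: "c \<noteq> 0" "\<And>x. disc {1..n} x = c * (vandermonde n x)\<^sup>2"
    using disc_eq_vandermonde_square by blast
  \<comment> \<open>The factors \<open>1 * x i\<close> exhibit the integrand as the twisted product
    with all twists equal to 1. Its nonzero average then shows that the common factor
    \<open>?C\<close> is nonzero.\<close>
  have aom: "aomoto {1..n} m {} (n * d) =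
    (\<lambda>x. c ^ m * (vandermonde n (\<lambda>i. 1 * x i) * vandermonde n x ^ (2 * m - 1) * (\<Sum>i\<in>{1..n}. x i) ^ (n * d)))"
  proof
    fix x :: "nat \<Rightarrow> complex"
    have "vandermonde n x * vandermonde n x ^ (2 * m - 1) = ((vandermonde n x)\<^sup>2) ^ m"
      using assms(2) by (simp add: power_mult[symmetric] flip: power_Suc)
    then show "aomoto {1..n} m {} (n * d) x =
        c ^ m * (vandermonde n (\<lambda>i. 1 * x i) * vandermonde n x ^ (2 * m - 1) * (\<Sum>i\<in>{1..n}. x i) ^ (n * d))"
      unfolding aomoto_def c(2) by (simp add: power_mult_distrib)
  qed
  have "?T (aomoto {1..n} m {} (n * d)) =
    c ^ m * ((\<Sum>\<sigma> | \<sigma> permutes {1..n}. \<Prod>i\<in>{1..n}. 1 ^ (\<sigma> i - 1)) * ?C)"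
    unfolding torus_sum_twisted_vandermonde[OF assms(2), symmetric]
    unfolding aom torus_sum_def grid_sum_cmult ..
  moreover have "?T (aomoto {1..n} m {} (n * d)) \<noteq> 0"
    using torus_sum_disc_power_sum_power_nonzero[of "{1..n}" m d M] assms by simp
  ultimately have "?C \<noteq> 0" by auto
  then show ?thesis
    unfolding torus_sum_twisted_vandermonde[OF assms(2)]
    using permanent_roots_of_unity_nonzero[OF assms(3-6)] by simp
qed

lemma card_pairs: "2 * card (pairs n) = n * (n - 1)"
proof (induction n)
  case 0
  have "pairs 0 = {}" by (auto simp: pairs_def)
  then show ?case by simp
next
  case (Suc n)
  have "pairs n \<inter> (\<lambda>i. (i, Suc n)) ` {1..n} = {}" by (auto simp: pairs_def)
  then have "card (pairs (Suc n)) = card (pairs n) + n"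
    unfolding pairs_Suc by (subst card_Un_disjoint) (auto simp: card_image inj_on_def)
  with Suc show ?case by (cases n) auto
qed

text \<open>Used to enlarge the set of sums and the sets \<open>S i j\<close> to exact sizes, so
  that the product has exactly the degree the grid argument requires.\<close>

lemma exists_finite_superset_card:
  fixes X :: "complex set"
  assumes "finite X" "card X \<le> N"
  shows "\<exists>Y. X \<subseteq> Y \<and> finite Y \<and> card Y = N"
proof -
  obtain B :: "complex set" where B: "finite B" "card B = N"
    using infinite_arbitrarily_large[OF infinite_UNIV_char_0] by blast
  then have "N \<le> card (X \<union> B)" using assms by (metis card_mono finite_UnI sup_ge2)
  then obtain Y where "X \<subseteq> Y" "Y \<subseteq> X \<union> B" "card Y = N"
    using exists_subset_between[of X N "X \<union> B"] assms B by auto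
  then show ?thesis using assms B by (metis finite_UnI finite_subset)
qed

theorem theorem1p2:
  fixes k m n q :: nat
    and A :: "nat \<Rightarrow> complex set"
    and S :: "nat \<Rightarrow> nat \<Rightarrow> complex set"
    and \<zeta> :: "nat \<Rightarrow> complex"
  assumes "k > 0" and "m > 0" and "n > 0"
    and "\<And>i. i \<in> {1..n} \<Longrightarrow> finite (A i) \<and> card (A i) = k"
    and "\<And>i j. 1 \<le> i \<Longrightarrow> i < j \<Longrightarrow> j \<le> n \<Longrightarrow> finite (S i j) \<and> card (S i j) \<le> 2 * m - 1"
    and "q > 0" and "odd q"
    and "\<And>i. i \<in> {1..n} \<Longrightarrow> \<zeta> i ^ q = 1"
    and "inj_on \<zeta> {1..n}"
  shows "int (card {\<Sum>i = 1..n. a i | a.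
            (\<forall>i \<in> {1..n}. a i \<in> A i) \<and>
            (\<forall>i j. 1 \<le> i \<and> i < j \<and> j \<le> n \<longrightarrow>
               a i * \<zeta> i \<noteq> a j * \<zeta> j \<and> a i - a j \<notin> S i j)})
         \<ge> (int k - 1 - int m * (int n - 1)) * int n + 1"
    (is "int (card ?X) \<ge> ?rhs")
proof (cases "k - 1 < m * (n - 1)")
  \<comment> \<open>Here the bound is at most \<open>1 - n\<close>, hence not positive.\<close>
  case True
  then have "int (k - 1) < int (m * (n - 1))" by linarith
  then have "int k - 1 - int m * (int n - 1) \<le> - 1"
    using assms(1,3) by (simp add: of_nat_diff)
  then have "(int k - 1 - int m * (int n - 1)) * int n \<le> - 1 * int n"
    by (intro mult_right_mono) auto
  then show ?thesis using assms(3) by linarith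
next
  case False
  define d where "d = k - 1 - m * (n - 1)"
  have kd: "k - 1 = d + m * (n - 1)" using False by (simp add: d_def)
  have finX: "finite ?X"
  proof (rule finite_subset)
    show "?X \<subseteq> (\<lambda>a. \<Sum>i = 1..n. a i) ` PiE {1..n} A"
    proof safe
      fix a :: "nat \<Rightarrow> complex" assume "\<forall>i\<in>{1..n}. a i \<in> A i"
      then show "(\<Sum>i = 1..n. a i) \<in> (\<lambda>a. \<Sum>i = 1..n. a i) ` PiE {1..n} A"
        by (intro image_eqI[of _ _ "restrict a {1..n}"]) auto
    qed
    show "finite ((\<lambda>a. \<Sum>i = 1..n. a i) ` PiE {1..n} A)"
      using assms(4) by (intro finite_imageI finite_PiE) auto
  qed
  \<comment> \<open>The number \<open>n * d\<close> is one less than the claimed bound.\<close>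
  have "\<not> card ?X \<le> n * d"
  proof
    assume "card ?X \<le> n * d"
    then obtain C where C: "?X \<subseteq> C" "finite C" "card C = n * d"
      using exists_finite_superset_card[OF finX] by blast
    have "\<exists>S'. \<forall>p\<in>pairs n. S (fst p) (snd p) \<subseteq> S' p \<and> finite (S' p) \<and> card (S' p) = 2 * m - 1"
      using assms(5) by (intro bchoice ballI exists_finite_superset_card) (auto simp: pairs_def)
    then obtain S' where S': "\<And>p. p \<in> pairs n \<Longrightarrow>
        S (fst p) (snd p) \<subseteq> S' p \<and> finite (S' p) \<and> card (S' p) = 2 * m - 1"
      by blast
    \<comment> \<open>Written to match \<open>affine_prod_diff\<close>: for
      \<open>p = (i, j)\<close> the factor of \<open>s\<close> is \<open>x j - x i + s\<close>,
      which vanishes exactly when \<open>x i - x j = s\<close>.\<close>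
    define f where "f p x = (\<zeta> (snd p) * x (snd p) - \<zeta> (fst p) * x (fst p)) *
      (\<Prod>s\<in>S' p. 1 * x (snd p) - 1 * x (fst p) - (- s))" for p and x :: "nat \<Rightarrow> complex"
    define g where "g p x = (\<zeta> (snd p) * x (snd p) - \<zeta> (fst p) * x (fst p)) *
      (\<Prod>s\<in>S' p. 1 * x (snd p) - 1 * x (fst p))" for p and x :: "nat \<Rightarrow> complex"
    define P where "P x = (\<Prod>p\<in>pairs n. f p x) * (\<Prod>c\<in>C. (\<Sum>i\<in>{1..n}. 1 * x i) - c)" for x
    define G where "G x = (\<Prod>p\<in>pairs n. g p x) * (\<Prod>c\<in>C. \<Sum>i\<in>{1..n}. 1 * x i)" for x
    have "affine_prod {1..n} (2 * m) (f p) (g p)" if p: "p \<in> pairs n" for p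
    proof -
      have mem: "fst p \<in> {1..n}" "snd p \<in> {1..n}" using p by (auto simp: pairs_def)
      have "affine_prod {1..n} (1 + (\<Sum>s\<in>S' p. 1)) (f p) (g p)"
        unfolding f_def g_def
        using S'[OF p] mem affine_prod_diff[OF _ mem(2,1), of "\<zeta> (snd p)" "\<zeta> (fst p)" 0]
        by (intro affine_prod_mult affine_prod_prod affine_prod_diff) auto
      then show ?thesis using S'[OF p] assms(2) by simp
    qed
    then have "affine_prod {1..n} ((\<Sum>p\<in>pairs n. 2 * m) + (\<Sum>c\<in>C. 1)) P G"
      unfolding P_def G_def using C
      by (intro affine_prod_mult affine_prod_prod affine_prod_single) auto
    moreover have "(\<Sum>p\<in>pairs n. 2 * m) + (\<Sum>c\<in>C. 1) = card {1..n} * (k - 1)"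
    proof -
      have "(\<Sum>p\<in>pairs n. 2 * m) = m * (2 * card (pairs n))" by simp
      then show ?thesis unfolding card_pairs kd using C by (simp add: algebra_simps)
    qed
    ultimately have aff: "affine_prod {1..n} (card {1..n} * (k - 1)) P G" by simp
    \<comment> \<open>Any order exceeding \<open>k - 1\<close> and \<open>2 * m * n + n * d\<close>
      serves.\<close>
    define M where "M = Suc (k + 2 * m * n + n * d)"
    have "P a = 0" if a: "a \<in> PiE {1..n} A" for a
    proof (cases "\<exists>p\<in>pairs n. f p a = 0")
      case True
      then show ?thesis unfolding P_def by (auto intro: prod_zero)
    next
      case False
      \<comment> \<open>If no \<open>f p a\<close> vanishes, then \<open>a\<close> is admissible;
        its sum lies in \<open>C\<close> and kills a factor of the product over
        \<open>C\<close>.\<close>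
      have "a i * \<zeta> i \<noteq> a j * \<zeta> j \<and> a i - a j \<notin> S i j" if "1 \<le> i \<and> i < j \<and> j \<le> n" for i j
      proof -
        have p: "(i, j) \<in> pairs n" using that by (simp add: pairs_def)
        then have "f (i, j) a \<noteq> 0" using False by blast
        then have "\<zeta> j * a j - \<zeta> i * a i \<noteq> 0" "\<And>s. s \<in> S' (i, j) \<Longrightarrow> a j - a i + s \<noteq> 0"
          using S'[OF p] by (auto simp: f_def)
        then show ?thesis using S'[OF p] by (fastforce simp: mult.commute)
      qed
      then have "(\<Sum>i = 1..n. a i) \<in> ?X" using a by (auto simp: PiE_iff)
      then have "(\<Sum>i = 1..n. a i) \<in> C" using C by blast
      then show ?thesis unfolding P_def using C by (auto intro: prod_zero)
    qed
    then have "grid_sum {1..n} A (\<lambda>i x. 1 / (\<Prod>y\<in>A i - {x}. x - y)) P = 0"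
      by (rule grid_sum_eq_0)
    moreover have "grid_sum {1..n} A (\<lambda>i x. 1 / (\<Prod>y\<in>A i - {x}. x - y)) P = torus_sum {1..n} M (k - 1) G"
      unfolding torus_sum_def
      using assms(1,4) by (intro grid_sum_leading_part[OF aff] lagrange_leading_moments torus_leading_moments)
        (auto simp: M_def)
    moreover have "G = (\<lambda>x. vandermonde n (\<lambda>i. \<zeta> i * x i) * vandermonde n x ^ (2 * m - 1) * (\<Sum>i\<in>{1..n}. x i) ^ (n * d))"
    proof
      fix x :: "nat \<Rightarrow> complex"
      have "(\<Prod>p\<in>pairs n. g p x) = (\<Prod>p\<in>pairs n. (\<zeta> (snd p) * x (snd p) - \<zeta> (fst p) * x (fst p)) *
          (x (snd p) - x (fst p)) ^ (2 * m - 1))"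
        using S' by (intro prod.cong refl) (simp add: g_def)
      then show "G x = vandermonde n (\<lambda>i. \<zeta> i * x i) * vandermonde n x ^ (2 * m - 1) * (\<Sum>i\<in>{1..n}. x i) ^ (n * d)"
        using C by (simp add: G_def vandermonde_def prod.distrib prod_power_distrib case_prod_unfold)
    qed
    moreover have "torus_sum {1..n} M (d + m * (n - 1))
      (\<lambda>x. vandermonde n (\<lambda>i. \<zeta> i * x i) * vandermonde n x ^ (2 * m - 1) * (\<Sum>i\<in>{1..n}. x i) ^ (n * d)) \<noteq> 0"
      using assms kd by (intro torus_sum_twisted_vandermonde_nonzero[of n m q]) (auto simp: M_def)
    ultimately show False using kd by simp
  qed
  then have "int (n * d) + 1 \<le> int (card ?X)" by linarith
  moreover have "int d = int k - 1 - int m * (int n - 1)"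
  proof -
    have "int (k - 1) = int d + int m * int (n - 1)" unfolding kd by simp
    then show ?thesis using assms(1,3) by (simp add: of_nat_diff)
  qed
  ultimately show ?thesis by (simp add: mult.commute)
qed

end
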